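(* Let $\mathcal{P}$ be an admissible set of abstract patterns in $\mathbb{R}^d$ which is linearly repetitive, and let $F:\mathcal{P}_{\rm b}\to\mathbb{R}$ be subadditive. Then the limits $\lim_{r\to\infty}F^+(r)$ and $\lim_{r\to\infty}F^-(r)$ exist and are equal. In particular, $$\lim_{r\to\infty}F^+(r)=\lim_{|P|\to\infty,\;P\in\mathcal{P}(\infty)}\frac{F(P)}{|P|}.$$
   Context: Patterns. A tile is a subset of $\mathbb{R}^d$ homeomorphic to the closed unit ball. A pattern is a nonempty finite set of tiles that are pairwise disjoint up to their boundaries. (Decorated patterns, whose tiles carry labels from a set $\Gamma$, are also allowed; all definitions apply to them in the obvious way, labels being preserved.) For a pattern $M$ put $s(M)=\bigcup_{m\in M}m$. With $K(x,r)$ the closed ball, $r_{\rm in}(M)=\max\{r:\exists x\ K(x,r)\subset s(M)\}$ and $r_{\rm out}(M)=\min\{r:\exists x\ K(x,r)\supset s(M)\}$. An abstract pattern (pattern class) is an equivalence class of patterns modulo translation; $r_{\rm in}$, $r_{\rm out}$ are defined on classes. For abstract patterns, $Q\subset P$ (also: $Q$ is contained in $P$) means that some representative of $Q$ is a subset of some representative of $P$. An abstract tile is a translation class of tiles. Admissibility. A nonempty set $\mathcal{P}$ of abstract patterns in $\mathbb{R}^d$ is admissible if: (i) $P\in\mathcal{P}$ and $Q\subset P$ imply $Q\in\mathcal{P}$; (ii) there are $0<r_{\min},r_{\max}<\infty$ with $r_{\min}\le r_{\rm in}(a)\le r_{\rm out}(a)\le r_{\max}$ for all abstract tiles $a$ in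 $\mathcal{P}$; (iii) for every $P\in\mathcal{P}$ with representative $\dot P$ such that $0\in s(\dot P)$, and every $r>0$, there is $Q\in\mathcal{P}$ with representative $\dot Q$ such that $K(0,r)\subset s(\dot Q)$ and $\dot P\subset\dot Q$. Linear repetitivity. An admissible $\mathcal{P}$ is linearly repetitive if there is $c_{\rm LR}>0$ such that every $P\in\mathcal{P}$ with $r_{\rm out}(P)\ge1$ is contained in every $Q\in\mathcal{P}$ with $r_{\rm in}(Q)\ge c_{\rm LR}\cdot r_{\rm out}(P)$. Boxes. A box is $B=\prod_{j=1}^d[a_j,b_j]$ with $a_j<b_j$; its side lengths are $l_j=b_j-a_j$, its volume is $|B|$, its width is $\omega(B)=\min_j l_j$. For $r>0$ an $r$-box is a box with $r\le l_j\le 2r$ for all $j$. We write $B=\bigoplus_{j=1}^nB_j$ if the boxes $B_j$ are pairwise disjoint up to boundaries and have union $B$. Box-patterns. If $s(M)\supset B$, put $M\cap B=\{m\cap B: m\in M,\ m\cap{\rm int}(B)\ne\emptyset\}$ (the sets $m\cap B$ need not be homeomorphic to balls). $\mathcal{P}_{\rm b}$ is the set of translation classes of all $\dot P\cap B$, where $\dot P$ is a representative of some $P\in\mathcal{P}$ and $B\subset s(\dot P)$ is a box; such a class has $|\cdot|$ and $\omega$ inherited from $B$. $\mathcal{P}(r)$ is the subset of those classes for which $B$ is an $r$-box, and $\mathcal{P}(\infty)=\bigcup_{r>0}\mathcal{P}(r)$. For $P,P_1,\dots,P_n\in\mathcal{P}_{\rm b}$, $P=\bigoplus_{j=1}^nP_j$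 means that there are representatives $\dot P,\dot P_j$ with $s(\dot P)=\bigoplus_{j=1}^n s(\dot P_j)$ and $\dot P_j=\dot P\cap s(\dot P_j)$ for all $j$. Subadditivity. $F:\mathcal{P}_{\rm b}\to\mathbb{R}$ is subadditive if there are constants $d_F,r_F\ge0$ and a nonincreasing function $c_F:[r_F,\infty)\to\mathbb{R}$ with $\lim_{r\to\infty}c_F(r)=0$ such that (i) $F(P)\le\sum_{j=1}^nF(P_j)+\sum_{j=1}^nc_F(\omega(P_j))|P_j|$ whenever $P=\bigoplus_{j=1}^nP_j$ with all $\omega(P_j)\ge r_F$; (ii) $|F(P)|\le d_F|P|$ for all $P\in\mathcal{P}_{\rm b}$. Means. For $r\ge r_F$ (and $r>0$), $F^+(r)=\sup\{F(P)/|P|:P\in\mathcal{P}(r)\}$ and $F^-(r)=\inf\{F(P)/|P|:P\in\mathcal{P}(r)\}$. *)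

theory Defs
  imports "HOL-Analysis.Analysis" "HOL-Library.Going_To_Filter"
begin

text \<open>The space \<open>\<real>\<^sup>d\<close> is a type \<open>'a :: euclidean_space\<close>, with coordinates taken along \<open>Basis\<close>.
  Tiles carry labels from \<open>'l\<close>; undecorated patterns are the case \<open>'l = unit\<close>.
  The same type also serves for box-patterns, whose pieces need not be homeomorphic to balls.\<close>

type_synonym ('a, 'l) pattern = "('a set \<times> 'l) set"

definition is_tile :: "'a::euclidean_space set \<Rightarrow> bool" where
  "is_tile m \<longleftrightarrow> m homeomorphic (cball 0 1 :: 'a set)"

definition disjoint_upto_boundary :: "'a::topological_space set \<Rightarrow> 'a set \<Rightarrow> bool" where
  "disjoint_upto_boundary A B \<longleftrightarrow> interior A \<inter> interior B = {}"

definition is_pattern :: "('a::euclidean_space, 'l) pattern \<Rightarrow> bool" where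
  "is_pattern M \<longleftrightarrow> finite M \<and> M \<noteq> {} \<and> (\<forall>t\<in>M. is_tile (fst t)) \<and>
     (\<forall>t\<in>M. \<forall>u\<in>M. t \<noteq> u \<longrightarrow> disjoint_upto_boundary (fst t) (fst u))"

definition supp :: "('a, 'l) pattern \<Rightarrow> 'a set" where
  "supp M = \<Union> (fst ` M)"

definition inradius :: "('a::euclidean_space, 'l) pattern \<Rightarrow> real" where
  "inradius M = Sup {r. \<exists>x. cball x r \<subseteq> supp M}"

definition outradius :: "('a::euclidean_space, 'l) pattern \<Rightarrow> real" where
  "outradius M = Inf {r. \<exists>x. supp M \<subseteq> cball x r}"


subsection \<open>Translation classes\<close>

definition translate :: "'a::euclidean_space \<Rightarrow> ('a, 'l) pattern \<Rightarrow> ('a, 'l) pattern" where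
  "translate v M = (\<lambda>(m, g). ((+) v ` m, g)) ` M"

definition tclass :: "('a::euclidean_space, 'l) pattern \<Rightarrow> ('a, 'l) pattern set" where
  "tclass M = range (\<lambda>v. translate v M)"

definition abstract_patterns :: "('a::euclidean_space, 'l) pattern set set" where
  "abstract_patterns = tclass ` {M. is_pattern M}"

text \<open>Translation invariant quantities are transferred to classes through an arbitrary
  representative; see the lemmas \<open>class_inradius_tclass\<close>, \<open>class_outradius_tclass\<close>,
  \<open>volume_box_pattern\<close> and \<open>width_box_pattern\<close> below.\<close>

definition representative :: "('a, 'l) pattern set \<Rightarrow> ('a, 'l) pattern" where
  "representative P = (SOME M. M \<in> P)"

definition class_inradius :: "('a::euclidean_space, 'l) pattern set \<Rightarrow> real" where
  "class_inradius P = inradius (representative P)"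

definition class_outradius :: "('a::euclidean_space, 'l) pattern set \<Rightarrow> real" where
  "class_outradius P = outradius (representative P)"

definition contained_in :: "('a, 'l) pattern set \<Rightarrow> ('a, 'l) pattern set \<Rightarrow> bool" where
  "contained_in Q P \<longleftrightarrow> (\<exists>M\<in>Q. \<exists>N\<in>P. M \<subseteq> N)"


subsection \<open>Admissibility and linear repetitivity\<close>

text \<open>An abstract tile in \<open>PP\<close> is a translation class in \<open>PP\<close> of a one-tile pattern.\<close>

definition admissible :: "('a::euclidean_space, 'l) pattern set set \<Rightarrow> bool" where
  "admissible PP \<longleftrightarrow> PP \<noteq> {} \<and> PP \<subseteq> abstract_patterns \<and>
     (\<forall>P\<in>PP. \<forall>Q\<in>abstract_patterns. contained_in Q P \<longrightarrow> Q \<in> PP) \<and>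
     (\<exists>rmin rmax. 0 < rmin \<and> 0 < rmax \<and>
        (\<forall>t. tclass {t} \<in> PP \<longrightarrow>
           rmin \<le> class_inradius (tclass {t}) \<and>
           class_inradius (tclass {t}) \<le> class_outradius (tclass {t}) \<and>
           class_outradius (tclass {t}) \<le> rmax)) \<and>
     (\<forall>P\<in>PP. \<forall>M\<in>P. 0 \<in> supp M \<longrightarrow>
        (\<forall>r>0. \<exists>Q\<in>PP. \<exists>N\<in>Q. cball 0 r \<subseteq> supp N \<and> M \<subseteq> N))"

definition linearly_repetitive :: "('a::euclidean_space, 'l) pattern set set \<Rightarrow> bool" where
  "linearly_repetitive PP \<longleftrightarrow> (\<exists>c>0. \<forall>P\<in>PP. class_outradius P \<ge> 1 \<longrightarrow>
     (\<forall>Q\<in>PP. class_inradius Q \<ge> c * class_outradius P \<longrightarrow> contained_in P Q))"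


subsection \<open>Boxes and box-patterns\<close>

definition is_box :: "'a::euclidean_space set \<Rightarrow> bool" where
  "is_box B \<longleftrightarrow> (\<exists>a b. (\<forall>i\<in>Basis. a \<bullet> i < b \<bullet> i) \<and> B = cbox a b)"

definition side_length :: "'a::euclidean_space set \<Rightarrow> 'a \<Rightarrow> real" where
  "side_length B i = interval_upperbound B \<bullet> i - interval_lowerbound B \<bullet> i"

definition box_width :: "'a::euclidean_space set \<Rightarrow> real" where
  "box_width B = Min (side_length B ` Basis)"

definition is_r_box :: "real \<Rightarrow> 'a::euclidean_space set \<Rightarrow> bool" where
  "is_r_box r B \<longleftrightarrow> is_box B \<and> (\<forall>i\<in>Basis. r \<le> side_length B i \<and> side_length B i \<le> 2 * r)"

definition box_sum :: "'a::euclidean_space set \<Rightarrow> nat \<Rightarrow> (nat \<Rightarrow> 'a set) \<Rightarrow> bool" where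
  "box_sum B n Bs \<longleftrightarrow> is_box B \<and> (\<forall>j\<in>{1..n}. is_box (Bs j)) \<and>
     (\<forall>i\<in>{1..n}. \<forall>j\<in>{1..n}. i \<noteq> j \<longrightarrow> disjoint_upto_boundary (Bs i) (Bs j)) \<and>
     (\<Union>j\<in>{1..n}. Bs j) = B"

text \<open>This is used for \<open>B \<subseteq> supp M\<close> only.\<close>

definition cut_box :: "('a::euclidean_space, 'l) pattern \<Rightarrow> 'a set \<Rightarrow> ('a, 'l) pattern" where
  "cut_box M B = {(m \<inter> B, g) | m g. (m, g) \<in> M \<and> m \<inter> interior B \<noteq> {}}"

definition box_patterns :: "('a::euclidean_space, 'l) pattern set set \<Rightarrow> ('a, 'l) pattern set set" where
  "box_patterns PP = {tclass (cut_box M B) | M B. (\<exists>P\<in>PP. M \<in> P) \<and> is_box B \<and> B \<subseteq> supp M}"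

definition r_box_patterns ::
    "('a::euclidean_space, 'l) pattern set set \<Rightarrow> real \<Rightarrow> ('a, 'l) pattern set set" where
  "r_box_patterns PP r = {tclass (cut_box M B) | M B. (\<exists>P\<in>PP. M \<in> P) \<and> is_r_box r B \<and> B \<subseteq> supp M}"

definition all_r_box_patterns ::
    "('a::euclidean_space, 'l) pattern set set \<Rightarrow> ('a, 'l) pattern set set" where
  "all_r_box_patterns PP = (\<Union>r\<in>{0<..}. r_box_patterns PP r)"

text \<open>The box of a representative of a box-pattern class is recovered as its support.\<close>

definition pattern_volume :: "('a::euclidean_space, 'l) pattern set \<Rightarrow> real" where
  "pattern_volume P = measure lborel (supp (representative P))"

definition pattern_width :: "('a::euclidean_space, 'l) pattern set \<Rightarrow> real" where
  "pattern_width P = box_width (supp (representative P))"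

definition pattern_sum ::
    "('a::euclidean_space, 'l) pattern set \<Rightarrow> nat \<Rightarrow> (nat \<Rightarrow> ('a, 'l) pattern set) \<Rightarrow> bool" where
  "pattern_sum P n Ps \<longleftrightarrow> (\<exists>M\<in>P. \<exists>Ms. (\<forall>j\<in>{1..n}. Ms j \<in> Ps j) \<and>
     box_sum (supp M) n (\<lambda>j. supp (Ms j)) \<and>
     (\<forall>j\<in>{1..n}. Ms j = cut_box M (supp (Ms j))))"


subsection \<open>Subadditive functions and their means\<close>

text \<open>Functions on box-patterns are total functions whose values outside
  \<open>box_patterns PP\<close> are irrelevant.\<close>

definition box_subadditive ::
    "('a::euclidean_space, 'l) pattern set set \<Rightarrow> (('a, 'l) pattern set \<Rightarrow> real) \<Rightarrow> bool" where
  "box_subadditive PP F \<longleftrightarrow> (\<exists>dF rF cF. 0 \<le> dF \<and> 0 \<le> rF \<and>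
     antimono_on {rF..} cF \<and> (cF \<longlongrightarrow> (0::real)) at_top \<and>
     (\<forall>P\<in>box_patterns PP. \<forall>n Ps.
        (\<forall>j\<in>{1..n}. Ps j \<in> box_patterns PP \<and> rF \<le> pattern_width (Ps j)) \<and> pattern_sum P n Ps \<longrightarrow>
        F P \<le> (\<Sum>j=1..n. F (Ps j)) + (\<Sum>j=1..n. cF (pattern_width (Ps j)) * pattern_volume (Ps j))) \<and>
     (\<forall>P\<in>box_patterns PP. \<bar>F P\<bar> \<le> dF * pattern_volume P))"

definition upper_mean ::
    "('a::euclidean_space, 'l) pattern set set \<Rightarrow> (('a, 'l) pattern set \<Rightarrow> real) \<Rightarrow> real \<Rightarrow> real" where
  "upper_mean PP F r = (SUP P\<in>r_box_patterns PP r. F P / pattern_volume P)"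

definition lower_mean ::
    "('a::euclidean_space, 'l) pattern set set \<Rightarrow> (('a, 'l) pattern set \<Rightarrow> real) \<Rightarrow> real \<Rightarrow> real" where
  "lower_mean PP F r = (INF P\<in>r_box_patterns PP r. F P / pattern_volume P)"


subsection \<open>Independence of representatives\<close>

lemma translate_0 [simp]: "translate 0 M = M"
  by (force simp: translate_def)

lemma representative_tclass: "\<exists>v. representative (tclass M) = translate v M"
proof -
  have "translate 0 M \<in> tclass M" unfolding tclass_def by blast
  then have "representative (tclass M) \<in> tclass M"
    unfolding representative_def by (rule someI)
  then show ?thesis by (auto simp: tclass_def)
qed

lemma supp_translate: "supp (translate v M) = (+) v ` supp M"
  by (force simp: supp_def translate_def)

lemma subset_translate_iff: "A \<subseteq> (+) v ` B \<longleftrightarrow> (+) (- v) ` A \<subseteq> (B :: 'a::ab_group_add set)"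
proof
  assume "A \<subseteq> (+) v ` B" then show "(+) (- v) ` A \<subseteq> B" by auto
next
  assume *: "(+) (- v) ` A \<subseteq> B"
  show "A \<subseteq> (+) v ` B"
  proof
    fix x assume "x \<in> A"
    then have "- v + x \<in> B" using * by blast
    then have "v + (- v + x) \<in> (+) v ` B" by blast
    then show "x \<in> (+) v ` B" by simp
  qed
qed

lemma inradius_translate: "inradius (translate v M) = inradius M"
proof -
  have "(\<exists>x. cball x r \<subseteq> (+) v ` supp M) \<longleftrightarrow> (\<exists>x. cball x r \<subseteq> supp M)" for r
  proof
    assume "\<exists>x. cball x r \<subseteq> (+) v ` supp M"
    then obtain x where "cball x r \<subseteq> (+) v ` supp M" by blast
    then have "cball (- v + x) r \<subseteq> supp M"
      by (simp only: subset_translate_iff cball_translation)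
    then show "\<exists>x. cball x r \<subseteq> supp M" by blast
  next
    assume "\<exists>x. cball x r \<subseteq> supp M"
    then obtain x where "cball x r \<subseteq> supp M" by blast
    then have "cball (v + x) r \<subseteq> (+) v ` supp M"
      by (auto simp only: cball_translation intro!: image_mono)
    then show "\<exists>x. cball x r \<subseteq> (+) v ` supp M" by blast
  qed
  then show ?thesis by (simp add: inradius_def supp_translate)
qed

lemma outradius_translate: "outradius (translate v M) = outradius M"
proof -
  have "(\<exists>x. (+) v ` supp M \<subseteq> cball x r) \<longleftrightarrow> (\<exists>x. supp M \<subseteq> cball x r)" for r
  proof
    assume "\<exists>x. (+) v ` supp M \<subseteq> cball x r"
    then obtain x where "(+) v ` supp M \<subseteq> cball x r" by blast
    then have "supp M \<subseteq> cball (- v + x) r"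
      by (simp only: cball_translation subset_translate_iff) simp
    then show "\<exists>x. supp M \<subseteq> cball x r" by blast
  next
    assume "\<exists>x. supp M \<subseteq> cball x r"
    then obtain x where "supp M \<subseteq> cball x r" by blast
    then have "(+) v ` supp M \<subseteq> cball (v + x) r"
      by (auto simp only: cball_translation intro!: image_mono)
    then show "\<exists>x. (+) v ` supp M \<subseteq> cball x r" by blast
  qed
  then show ?thesis by (simp add: outradius_def supp_translate)
qed

lemma class_inradius_tclass: "class_inradius (tclass M) = inradius M"
  using representative_tclass[of M] by (auto simp: class_inradius_def inradius_translate)

lemma class_outradius_tclass: "class_outradius (tclass M) = outradius M"
  using representative_tclass[of M] by (auto simp: class_outradius_def outradius_translate)

lemma supp_cut_box:
  assumes "is_pattern M" "is_box B" "B \<subseteq> supp M"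
  shows "supp (cut_box M B) = B"
proof
  show "supp (cut_box M B) \<subseteq> B" by (auto simp: supp_def cut_box_def)
next
  obtain a b where ab: "\<forall>i\<in>Basis. a \<bullet> i < b \<bullet> i" "B = cbox a b"
    using assms(2) by (auto simp: is_box_def)
  have "compact (fst t)" if "t \<in> M" for t
    using assms(1) that homeomorphic_compactness[of "fst t" "cball 0 1 :: 'a set"]
    by (simp add: is_pattern_def is_tile_def)
  then have cl: "closed (fst t \<inter> B)" if "t \<in> M" for t
    using that unfolding ab(2) by (intro closed_Int compact_imp_closed closed_cbox)
  moreover have "supp (cut_box M B) = (\<Union>t\<in>{t\<in>M. fst t \<inter> interior B \<noteq> {}}. fst t \<inter> B)"
  proof -
    have "cut_box M B = (\<lambda>t. (fst t \<inter> B, snd t)) ` {t\<in>M. fst t \<inter> interior B \<noteq> {}}"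
      by (force simp: cut_box_def)
    then show ?thesis by (simp only: supp_def image_image fst_conv)
  qed
  moreover have "closed (\<Union>t\<in>{t\<in>M. fst t \<inter> interior B \<noteq> {}}. fst t \<inter> B)"
  proof (rule closed_UN)
    show "finite {t\<in>M. fst t \<inter> interior B \<noteq> {}}"
      using assms(1) by (simp add: is_pattern_def)
    show "\<forall>t\<in>{t\<in>M. fst t \<inter> interior B \<noteq> {}}. closed (fst t \<inter> B)"
      using cl by blast
  qed
  ultimately have "closed (supp (cut_box M B))" by simp
  moreover have "interior B \<subseteq> supp (cut_box M B)"
  proof
    fix x assume x: "x \<in> interior B"
    then have "x \<in> B" using interior_subset by blast
    with assms(3) obtain m g where "(m, g) \<in> M" "x \<in> m"
      unfolding supp_def by fastforce
    then have "(m \<inter> B, g) \<in> cut_box M B" using x by (auto simp: cut_box_def)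
    with \<open>x \<in> m\<close> \<open>x \<in> B\<close> show "x \<in> supp (cut_box M B)" by (force simp: supp_def)
  qed
  moreover have "closure (interior B) = B"
    using ab by (simp add: interior_cbox closure_box box_ne_empty)
  ultimately show "B \<subseteq> supp (cut_box M B)" by (metis closure_minimal)
qed

lemma volume_box_pattern:
  assumes "is_pattern M" "is_box B" "B \<subseteq> supp M"
  shows "pattern_volume (tclass (cut_box M B)) = measure lborel B"
proof -
  obtain v where v: "representative (tclass (cut_box M B)) = translate v (cut_box M B)"
    using representative_tclass by blast
  obtain a b where ab: "\<forall>i\<in>Basis. a \<bullet> i < b \<bullet> i" "B = cbox a b"
    using assms(2) by (auto simp: is_box_def)
  have eq: "(+) v ` B = cbox (v + a) (v + b)" by (simp only: ab(2) cbox_translation)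
  have "supp (representative (tclass (cut_box M B))) = cbox (v + a) (v + b)"
    by (simp only: v supp_translate supp_cut_box[OF assms] eq)
  moreover have "measure lborel (cbox (v + a) (v + b)) = measure lborel (cbox a b)"
    using ab(1) by (simp add: content_cbox inner_add_left less_imp_le)
  ultimately show ?thesis by (simp only: pattern_volume_def ab(2))
qed

lemma width_box_pattern:
  assumes "is_pattern M" "is_box B" "B \<subseteq> supp M"
  shows "pattern_width (tclass (cut_box M B)) = box_width B"
proof -
  obtain v where v: "representative (tclass (cut_box M B)) = translate v (cut_box M B)"
    using representative_tclass by blast
  obtain a b where ab: "\<forall>i\<in>Basis. a \<bullet> i < b \<bullet> i" "B = cbox a b"
    using assms(2) by (auto simp: is_box_def)
  have "(+) v ` B = cbox (v + a) (v + b)" by (simp only: ab(2) cbox_translation)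
  then have "side_length ((+) v ` B) i = side_length B i" if "i \<in> Basis" for i
    using ab that by (simp add: side_length_def less_imp_le inner_add_left)
  then show ?thesis
    using v supp_cut_box[OF assms] by (simp add: pattern_width_def box_width_def supp_translate)
qed

end

theory Submission
  imports Defs
begin

text \<open>Dividing a large box into \<open>s\<close>-boxes shows that the mean of \<open>F\<close> on it exceeds
  \<open>F\<^sup>+(s)\<close> by at most \<open>c\<^sub>F(s)\<close>; hence \<open>F\<^sup>+\<close> converges. By linear repetitivity there is a
  constant \<open>C\<close> such that a copy of each \<open>r\<close>-box pattern \<open>P\<close> lies well inside every \<open>C r\<close>-box,
  where it fills a fraction of the volume bounded below by some \<open>\<delta> > 0\<close>. Extending this copy to a
  division of the \<open>C r\<close>-box into boxes of width at least \<open>r\<close>, subadditivity gives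
  \<open>\<delta> (F\<^sup>+(r) - F(P) / |P|) \<le> F\<^sup>+(r) - F\<^sup>+(C r) + 2 c\<^sub>F(r)\<close>, and the right-hand side tends
  to 0. So \<open>F\<^sup>-\<close> has the same limit.\<close>

subsection \<open>Tiles and translations\<close>

lemma tile_compact: "is_tile m \<Longrightarrow> compact m"
  unfolding is_tile_def using homeomorphic_compactness compact_cball by blast

text \<open>By invariance of domain the parametrization maps the open ball onto an open set, hence
  into \<open>interior m\<close>. By continuity the closed ball goes into the closure of that
  set.\<close>

lemma tile_subset_closure_interior:
  fixes m :: "'a::euclidean_space set"
  assumes "is_tile m"
  shows "m \<subseteq> closure (interior m)"
proof -
  have "(cball 0 1 :: 'a set) homeomorphic m"
    using assms unfolding is_tile_def by (rule homeomorphic_sym[THEN iffD1])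
  then obtain f g where "homeomorphism (cball 0 1 :: 'a set) m f g"
    unfolding homeomorphic_def by (elim exE)
  then have cont: "continuous_on (cball 0 1) f" and img: "f ` cball 0 1 = m"
    and inj: "inj_on f (cball 0 1)"
    by (auto simp: homeomorphism_def intro: inj_on_inverseI)
  have "open (f ` ball 0 1)"
    by (rule invariance_of_domain_ball[OF cont _ inj]) simp
  then have sub: "f ` ball 0 1 \<subseteq> interior m"
    using img by (metis ball_subset_cball image_mono interior_maximal)
  have "f ` closure (ball 0 1) \<subseteq> closure (f ` ball 0 1)"
    by (rule image_closure_subset) (simp_all add: cont closure_subset)
  then show ?thesis
    using closure_mono[OF sub] img by auto
qed

lemma tile_translation: "is_tile ((+) v ` m) \<longleftrightarrow> is_tile m"
  unfolding is_tile_def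
  by (metis homeomorphic_sym homeomorphic_trans homeomorphic_translation)

lemma translate_translate: "translate u (translate v M) = translate (u + v) M"
  by (force simp: translate_def image_image split_beta add.assoc)

lemma tclass_translate: "tclass (translate v M) = tclass M"
proof
  show "tclass (translate v M) \<subseteq> tclass M"
    by (auto simp: tclass_def translate_translate)
  have "translate u M = translate (u - v) (translate v M)" for u
    by (simp add: translate_translate)
  then show "tclass M \<subseteq> tclass (translate v M)"
    unfolding tclass_def by blast
qed

lemma mem_translate: "t \<in> translate v M \<longleftrightarrow> (\<exists>p\<in>M. t = ((+) v ` fst p, snd p))"
  by (simp add: translate_def image_iff split_beta)

lemma mem_supp: "x \<in> supp M \<longleftrightarrow> (\<exists>t\<in>M. x \<in> fst t)"
  by (simp add: supp_def)

lemma tclass_self: "M \<in> tclass M"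
  unfolding tclass_def using translate_0[of M] by (metis rangeI)

lemma pattern_translate:
  assumes "is_pattern M"
  shows "is_pattern (translate v M)"
proof -
  have disj: "disjoint_upto_boundary ((+) v ` A) ((+) v ` B) \<longleftrightarrow> disjoint_upto_boundary A B"
    for A B :: "'a set"
    unfolding disjoint_upto_boundary_def interior_translation
    by (auto simp flip: image_Int)
  have "disjoint_upto_boundary (fst t) (fst u)"
    if t: "t \<in> translate v M" and u: "u \<in> translate v M" and ne: "t \<noteq> u" for t u
  proof -
    from t u obtain p q where pq: "p \<in> M" "q \<in> M"
      and tu: "t = ((+) v ` fst p, snd p)" "u = ((+) v ` fst q, snd q)"
      unfolding mem_translate by blast
    then have "p \<noteq> q" using ne by auto
    then have "disjoint_upto_boundary (fst p) (fst q)"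
      using assms pq by (simp add: is_pattern_def)
    then show ?thesis using tu disj by simp
  qed
  moreover have "is_tile (fst t)" if "t \<in> translate v M" for t
    using that assms by (auto simp: is_pattern_def translate_def tile_translation)
  moreover have "finite (translate v M)" "translate v M \<noteq> {}"
    using assms by (simp_all add: is_pattern_def translate_def)
  ultimately show ?thesis unfolding is_pattern_def by blast
qed

lemma abstract_pattern_representative:
  assumes "P \<in> abstract_patterns" "M \<in> P"
  shows "is_pattern M" "P = tclass M"
proof -
  from assms obtain M0 v where "is_pattern M0" "P = tclass M0" "M = translate v M0"
    by (auto simp: abstract_patterns_def tclass_def)
  then show "is_pattern M" "P = tclass M"
    by (simp_all add: pattern_translate tclass_translate)
qed

lemma pattern_subset: "is_pattern M \<Longrightarrow> N \<subseteq> M \<Longrightarrow> N \<noteq> {} \<Longrightarrow> is_pattern N"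
  unfolding is_pattern_def by (meson finite_subset subset_eq)

lemma compact_supp: "is_pattern M \<Longrightarrow> compact (supp M)"
  unfolding is_pattern_def supp_def by (intro compact_Union) (auto intro: tile_compact)

subsection \<open>Cutting patterns by boxes\<close>

text \<open>\<open>pattern_sum\<close> cuts its pieces out of a box-pattern. This allows them to be
  cut out of the ambient pattern instead.\<close>

lemma cut_box_cut_box:
  assumes "B' \<subseteq> B"
  shows "cut_box (cut_box M B) B' = cut_box M B'"
proof (intro set_eqI iffI)
  fix t assume "t \<in> cut_box (cut_box M B) B'"
  then obtain m g where "(m, g) \<in> M" "t = (m \<inter> B \<inter> B', g)" "m \<inter> B \<inter> interior B' \<noteq> {}"
    unfolding cut_box_def by blast
  moreover from this have "m \<inter> B \<inter> B' = m \<inter> B'" "m \<inter> interior B' \<noteq> {}" using assms by blast+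
  ultimately show "t \<in> cut_box M B'" unfolding cut_box_def by auto
next
  fix t assume "t \<in> cut_box M B'"
  then obtain m g where m: "(m, g) \<in> M" "t = (m \<inter> B', g)" "m \<inter> interior B' \<noteq> {}"
    unfolding cut_box_def by blast
  then have "m \<inter> interior B \<noteq> {}" using interior_mono[OF assms] by blast
  then have "(m \<inter> B, g) \<in> cut_box M B" using m unfolding cut_box_def by blast
  moreover have "m \<inter> B \<inter> B' = m \<inter> B'" "m \<inter> B \<inter> interior B' \<noteq> {}"
    using assms m(3) interior_subset[of B'] by blast+
  ultimately show "t \<in> cut_box (cut_box M B) B'"
    using m(2) unfolding cut_box_def[of "cut_box M B"]
    by (intro CollectI exI[of _ "m \<inter> B"] exI[of _ g]) simp
qed

lemma cut_box_image:
  "cut_box M B = (\<lambda>(m, g). (m \<inter> B, g)) ` {t \<in> M. fst t \<inter> interior B \<noteq> {}}"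
  unfolding cut_box_def by force

lemma cut_box_translate:
  "cut_box (translate v M) ((+) v ` B) = translate v (cut_box M B)"
proof -
  have eq: "(+) v ` m \<inter> (+) v ` A = (+) v ` (m \<inter> A)" for m A
    by (simp add: image_Int)
  have "{t \<in> translate v M. fst t \<inter> interior ((+) v ` B) \<noteq> {}}
      = translate v {t \<in> M. fst t \<inter> interior B \<noteq> {}}"
    unfolding translate_def interior_translation Compr_image_eq
    by (simp add: eq split_beta)
  then show ?thesis
    unfolding cut_box_image by (simp add: translate_def image_image split_beta eq)
qed

text \<open>A tile is the closure of its interior, so no further tile of \<open>M\<close> can meet the interior
  of a region that \<open>N\<close> already covers.\<close>

lemma cut_box_subpattern:
  assumes M: "is_pattern M" and N: "N \<subseteq> M" and B: "B \<subseteq> supp N"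
  shows "cut_box M B = cut_box N B"
proof -
  have "t \<in> N" if t: "t \<in> M" "fst t \<inter> interior B \<noteq> {}" for t
  proof (rule ccontr)
    assume "t \<notin> N"
    \<comment> \<open>\<open>t\<close> lies in the closure of its interior, so the open set
      \<open>interior B\<close>, which meets \<open>t\<close>, must also meet the interior of
      \<open>t\<close>. The points of \<open>U\<close> are covered by tiles of \<open>N\<close>,
      which differ from \<open>t\<close>.\<close>
    define U where "U = interior (fst t) \<inter> interior B"
    have "fst t \<subseteq> closure (interior (fst t))"
      using M t by (simp add: is_pattern_def tile_subset_closure_interior)
    then have "U \<noteq> {}"
      using t(2) open_Int_closure_eq_empty[of "interior B" "interior (fst t)"]
      unfolding U_def by (auto simp: Int_commute)
    then obtain x where x: "x \<in> U" by blast
    then have "x \<in> supp N" using B interior_subset[of B] by (auto simp: U_def)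
    then obtain u where u: "u \<in> N" "x \<in> fst u" by (auto simp: mem_supp)
    then have "interior (fst t) \<inter> interior (fst u) = {}"
    proof -
      have "u \<in> M" "t \<noteq> u" using u(1) N \<open>t \<notin> N\<close> by auto
      then show ?thesis
        using M t(1) by (simp add: is_pattern_def disjoint_upto_boundary_def)
    qed
    \<comment> \<open>The point \<open>x\<close> may lie on the boundary of \<open>u\<close>.
      Disjointness is therefore extended to the closure of the interior of \<open>u\<close>, which
      contains all of \<open>u\<close>.\<close>
    then have "interior (fst t) \<inter> closure (interior (fst u)) = {}"
      by (simp add: open_Int_closure_eq_empty)
    moreover have "x \<in> closure (interior (fst u))"
    proof -
      have "is_tile (fst u)" using M N u(1) by (auto simp: is_pattern_def)
      then show ?thesis using tile_subset_closure_interior[of "fst u"] u(2) by blast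
    qed
    ultimately show False using x unfolding U_def by auto
  qed
  then have "{t \<in> M. fst t \<inter> interior B \<noteq> {}} = {t \<in> N. fst t \<inter> interior B \<noteq> {}}"
    using N by auto
  then show ?thesis
    by (simp only: cut_box_image)
qed

text \<open>Passing to the tiles that touch \<open>B\<close> keeps \<open>B\<close> covered while
  the size of the pattern becomes controlled by that of \<open>B\<close>.\<close>

lemma subset_supp_touching:
  assumes "B \<subseteq> supp M"
  shows "B \<subseteq> supp {t \<in> M. fst t \<inter> B \<noteq> {}}"
proof
  fix x assume "x \<in> B"
  then have "x \<in> supp M" using assms by (rule subsetD[rotated])
  then obtain t where "t \<in> M" "x \<in> fst t" unfolding mem_supp by (rule bexE)
  then show "x \<in> supp {t \<in> M. fst t \<inter> B \<noteq> {}}"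
    using \<open>x \<in> B\<close> unfolding mem_supp by (intro bexI[of _ t] CollectI conjI) auto
qed

subsection \<open>Boxes and divisions\<close>

lemma is_box_cbox: "is_box (cbox a b) \<longleftrightarrow> (\<forall>i\<in>Basis. a \<bullet> i < b \<bullet> i)"
proof
  assume "is_box (cbox a b)"
  then obtain c d where cd: "\<forall>i\<in>Basis. c \<bullet> i < d \<bullet> i" "cbox a b = cbox c d"
    unfolding is_box_def by blast
  then have "box c d \<noteq> {}" by (simp add: box_ne_empty)
  then have "box a b \<noteq> {}" using cd(2) by (metis interior_cbox)
  then show "\<forall>i\<in>Basis. a \<bullet> i < b \<bullet> i" by (simp add: box_ne_empty)
qed (auto simp: is_box_def)

lemma side_length_cbox:
  "\<forall>i\<in>Basis. a \<bullet> i < b \<bullet> i \<Longrightarrow> i \<in> Basis \<Longrightarrow> side_length (cbox a b) i = b \<bullet> i - a \<bullet> i"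
  by (simp add: side_length_def less_imp_le)

lemma box_width_ge_iff: "s \<le> box_width B \<longleftrightarrow> (\<forall>i\<in>Basis. s \<le> side_length (B::'a::euclidean_space set) i)"
  unfolding box_width_def by (subst Min_ge_iff) auto

lemma measure_box_pos: "is_box B \<Longrightarrow> 0 < measure lborel B"
  by (auto simp: is_box_def content_cbox_cases less_imp_le intro!: prod_pos)

text \<open>The hyperplane where coordinate \<open>i\<close> equals \<open>c\<close> cuts
  \<open>cbox a b\<close> into \<open>cbox a (set_coord b i c)\<close> and
  \<open>cbox (set_coord a i c) b\<close>: only one corner of each half changes.\<close>

definition set_coord :: "'a::euclidean_space \<Rightarrow> 'a \<Rightarrow> real \<Rightarrow> 'a" where
  "set_coord a i c = (\<Sum>j\<in>Basis. (if j = i then c else a \<bullet> j) *\<^sub>R j)"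

lemma inner_set_coord [simp]: "j \<in> Basis \<Longrightarrow> set_coord a i c \<bullet> j = (if j = i then c else a \<bullet> j)"
  by (simp add: set_coord_def)

lemma division_bisect:
  assumes i: "i \<in> Basis" and c: "a \<bullet> i \<le> c" "c \<le> b \<bullet> i"
    and D: "D division_of cbox a (set_coord b i c)"
    and E: "E division_of cbox (set_coord a i c) b"
  shows "(D \<union> E) division_of cbox a b"
proof -
  have "interior (cbox a (set_coord b i c)) \<inter> interior (cbox (set_coord a i c) b) = {}"
    using i by (force simp: interior_cbox mem_box)
  from division_disjoint_union[OF D E this]
  have "(D \<union> E) division_of (cbox a (set_coord b i c) \<union> cbox (set_coord a i c) b)" .
  moreover have "cbox a (set_coord b i c) \<union> cbox (set_coord a i c) b = cbox a b"
  proof (intro set_eqI iffI)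
    fix x assume "x \<in> cbox a (set_coord b i c) \<union> cbox (set_coord a i c) b"
    then show "x \<in> cbox a b"
      using i c by (fastforce simp: mem_box split: if_splits)
  next
    fix x assume "x \<in> cbox a b"
    then show "x \<in> cbox a (set_coord b i c) \<union> cbox (set_coord a i c) b"
      by (cases "x \<bullet> i \<le> c") (auto simp: mem_box)
  qed
  ultimately show ?thesis by simp
qed

text \<open>As long as some side exceeds \<open>2 * s\<close>, a slab of thickness \<open>s\<close>
  is cut off. Both parts keep all sides at least \<open>s\<close>, and the sum of the integer parts
  of side length over \<open>s\<close> drops, which drives the induction.\<close>

lemma division_into_r_boxes:
  fixes B :: "'a::euclidean_space set"
  assumes "s > 0" "is_box B" "s \<le> box_width B"
  shows "\<exists>D. D division_of B \<and> (\<forall>K\<in>D. is_r_box s K)"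
proof -
  have "\<exists>D. D division_of cbox a b \<and> (\<forall>K\<in>D. is_r_box s K)"
    if "\<forall>i\<in>Basis. s \<le> b \<bullet> i - a \<bullet> i" for a b :: 'a
    using that
  proof (induction "\<Sum>i\<in>Basis. nat \<lfloor>(b \<bullet> i - a \<bullet> i) / s\<rfloor>" arbitrary: a b rule: less_induct)
    case less
    have box: "\<forall>i\<in>Basis. a \<bullet> i < b \<bullet> i" using less.prems \<open>s > 0\<close> by force
    show ?case
    proof (cases "\<forall>i\<in>Basis. b \<bullet> i - a \<bullet> i \<le> 2 * s")
      case True
      then have "is_r_box s (cbox a b)"
        using less.prems box by (simp add: is_r_box_def is_box_cbox side_length_cbox)
      moreover have "{cbox a b} division_of cbox a b"
        using box by (intro division_of_self) (simp add: box_ne_empty less_imp_le)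
      ultimately show ?thesis by blast
    next
      case False
      then obtain i where i: "i \<in> Basis" "b \<bullet> i - a \<bullet> i > 2 * s" by force
      define c where "c = a \<bullet> i + s"
      \<comment> \<open>Shortening a side by at least \<open>s\<close> lowers its integer part by at
        least one. Nonnegativity of \<open>x\<close> keeps the truncation by \<open>nat\<close> from
        spoiling strictness.\<close>
      have fl: "nat \<lfloor>x / s\<rfloor> < nat \<lfloor>y / s\<rfloor>" if "0 \<le> x" "x + s \<le> y" for x y
      proof -
        have "x / s + 1 \<le> y / s" using divide_right_mono[OF that(2), of s] \<open>s > 0\<close>
          by (simp add: add_divide_distrib)
        then have "\<lfloor>x / s\<rfloor> + 1 \<le> \<lfloor>y / s\<rfloor>" by linarith
        moreover have "0 \<le> \<lfloor>x / s\<rfloor>" using that \<open>s > 0\<close> by simp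
        ultimately show ?thesis by linarith
      qed
      have dec: "(\<Sum>j\<in>Basis. nat \<lfloor>(y \<bullet> j - x \<bullet> j) / s\<rfloor>)
          < (\<Sum>j\<in>Basis. nat \<lfloor>(b \<bullet> j - a \<bullet> j) / s\<rfloor>)"
        if "\<forall>j\<in>Basis. j \<noteq> i \<longrightarrow> y \<bullet> j - x \<bullet> j = b \<bullet> j - a \<bullet> j"
          "0 \<le> y \<bullet> i - x \<bullet> i" "y \<bullet> i - x \<bullet> i + s \<le> b \<bullet> i - a \<bullet> i" for x y
      proof (rule sum_strict_mono_ex1)
        have "nat \<lfloor>(y \<bullet> i - x \<bullet> i) / s\<rfloor> < nat \<lfloor>(b \<bullet> i - a \<bullet> i) / s\<rfloor>"
          using that by (intro fl)
        then show "\<forall>j\<in>Basis. nat \<lfloor>(y \<bullet> j - x \<bullet> j) / s\<rfloor> \<le> nat \<lfloor>(b \<bullet> j - a \<bullet> j) / s\<rfloor>"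
          "\<exists>j\<in>Basis. nat \<lfloor>(y \<bullet> j - x \<bullet> j) / s\<rfloor> < nat \<lfloor>(b \<bullet> j - a \<bullet> j) / s\<rfloor>"
          using that(1) i(1) by (metis less_imp_le order_refl, blast)
      qed simp
      have "\<exists>D. D division_of cbox a (set_coord b i c) \<and> (\<forall>K\<in>D. is_r_box s K)"
        by (rule less.hyps[OF dec]) (use i less.prems \<open>s > 0\<close> in \<open>auto simp: c_def\<close>)
      moreover have "\<exists>D. D division_of cbox (set_coord a i c) b \<and> (\<forall>K\<in>D. is_r_box s K)"
        by (rule less.hyps[OF dec]) (use i less.prems \<open>s > 0\<close> in \<open>auto simp: c_def\<close>)
      moreover have "a \<bullet> i \<le> c" "c \<le> b \<bullet> i"
        using i \<open>s > 0\<close> by (auto simp: c_def)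
      ultimately show ?thesis
        using division_bisect[OF i(1)] by (metis UnE)
    qed
  qed
  then show ?thesis
    using assms(2,3) unfolding box_width_ge_iff by (auto simp: is_box_def side_length_cbox)
qed

text \<open>Slabs are cut off along the faces of the inner box, one face at a time. Each slab is at
  least \<open>s\<close> thick by the assumed gap, and its other sides are at least as long as those
  of the inner box.\<close>

lemma division_extending_inner_box:
  fixes a b c d :: "'a::euclidean_space"
  assumes "s > 0" and inner: "\<forall>i\<in>Basis. s \<le> d \<bullet> i - c \<bullet> i"
    and gap: "\<forall>i\<in>Basis. a \<bullet> i + s \<le> c \<bullet> i \<and> d \<bullet> i + s \<le> b \<bullet> i"
  shows "\<exists>D. D division_of cbox a b \<and> cbox c d \<in> D \<and> (\<forall>K\<in>D. is_box K \<and> s \<le> box_width K)"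
proof -
  let ?ok = "\<lambda>K. is_box K \<and> s \<le> box_width K"
  have ok: "?ok (cbox x y) \<and> {cbox x y} division_of cbox x y"
    if "\<forall>i\<in>Basis. s \<le> y \<bullet> i - x \<bullet> i" for x y :: 'a
  proof -
    have "\<forall>i\<in>Basis. x \<bullet> i < y \<bullet> i" using that \<open>s > 0\<close> by force
    then show ?thesis using that
      by (simp add: is_box_cbox box_width_ge_iff side_length_cbox division_of_self
          box_ne_empty less_imp_le)
  qed
  let ?bad = "\<lambda>x y. {i\<in>Basis. x \<bullet> i \<noteq> (y::'a) \<bullet> i}"
  have bad_set: "card (?bad (set_coord x i (y \<bullet> i)) y) < card (?bad x y)"
    if "i \<in> Basis" "x \<bullet> i \<noteq> y \<bullet> i" for x y i
  proof (rule psubset_card_mono)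
    have "i \<in> ?bad x y - ?bad (set_coord x i (y \<bullet> i)) y" using that by simp
    moreover have "?bad (set_coord x i (y \<bullet> i)) y \<subseteq> ?bad x y" by (auto split: if_splits)
    ultimately show "?bad (set_coord x i (y \<bullet> i)) y \<subset> ?bad x y" by blast
  qed simp
  \<comment> \<open>Generalized for induction on the number of faces not yet flush with the inner
    box: every face is either flush or at distance at least \<open>s\<close>, and cutting off a slab
    preserves this alternative.\<close>
  have "\<exists>D. D division_of cbox x y \<and> cbox c d \<in> D \<and> (\<forall>K\<in>D. ?ok K)"
    if "\<forall>i\<in>Basis. x \<bullet> i = c \<bullet> i \<or> x \<bullet> i + s \<le> c \<bullet> i"
       "\<forall>i\<in>Basis. y \<bullet> i = d \<bullet> i \<or> d \<bullet> i + s \<le> y \<bullet> i" for x y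
    using that
  proof (induction "card (?bad x c) + card (?bad y d)" arbitrary: x y rule: less_induct)
    case less
    have side: "s \<le> y \<bullet> i - x \<bullet> i" if "i \<in> Basis" for i
      using less.prems inner that \<open>s > 0\<close> by force
    consider i where "i \<in> Basis" "x \<bullet> i \<noteq> c \<bullet> i" | i where "i \<in> Basis" "y \<bullet> i \<noteq> d \<bullet> i"
      | "x = c" "y = d"
      by (metis euclidean_eqI)
    then show ?case
    proof cases
      case 1
      then have gap: "x \<bullet> i + s \<le> c \<bullet> i" using less.prems by blast
      have "\<exists>D. D division_of cbox (set_coord x i (c \<bullet> i)) y \<and> cbox c d \<in> D \<and> (\<forall>K\<in>D. ?ok K)"
        using bad_set[of i x c] 1 less.prems by (intro less.hyps) auto
      then obtain D where D: "D division_of cbox (set_coord x i (c \<bullet> i)) y" "cbox c d \<in> D"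
        "\<forall>K\<in>D. ?ok K" by blast
      let ?L = "cbox x (set_coord y i (c \<bullet> i))"
      have L: "?ok ?L \<and> {?L} division_of ?L" using side gap 1 by (intro ok) auto
      have "({?L} \<union> D) division_of cbox x y"
      proof (rule division_bisect[OF 1(1)])
        show "x \<bullet> i \<le> c \<bullet> i" "c \<bullet> i \<le> y \<bullet> i"
          using gap less.prems inner 1(1) \<open>s > 0\<close> by force+
      qed (use L D in auto)
      then show ?thesis using L D by (intro exI[of _ "{?L} \<union> D"]) simp
    next
      case 2
      then have gap: "d \<bullet> i + s \<le> y \<bullet> i" using less.prems by blast
      have "\<exists>D. D division_of cbox x (set_coord y i (d \<bullet> i)) \<and> cbox c d \<in> D \<and> (\<forall>K\<in>D. ?ok K)"
        using bad_set[of i y d] 2 less.prems by (intro less.hyps) auto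
      then obtain D where D: "D division_of cbox x (set_coord y i (d \<bullet> i))" "cbox c d \<in> D"
        "\<forall>K\<in>D. ?ok K" by blast
      let ?L = "cbox (set_coord x i (d \<bullet> i)) y"
      have L: "?ok ?L \<and> {?L} division_of ?L" using side gap 2 by (intro ok) auto
      have "(D \<union> {?L}) division_of cbox x y"
      proof (rule division_bisect[OF 2(1)])
        show "x \<bullet> i \<le> d \<bullet> i" "d \<bullet> i \<le> y \<bullet> i"
          using gap less.prems inner 2(1) \<open>s > 0\<close> by force+
      qed (use L D in auto)
      then show ?thesis using L D by (intro exI[of _ "D \<union> {?L}"]) simp
    next
      case 3
      then show ?thesis using ok[OF inner] by blast
    qed
  qed
  then show ?thesis using gap by blast
qed

subsection \<open>Admissible sets of patterns\<close>

lemma admissible_pattern: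
  assumes "admissible PP" "M \<in> \<Union>PP"
  shows "is_pattern M" "tclass M \<in> PP"
proof -
  from assms obtain P where "P \<in> PP" "M \<in> P" "P \<in> abstract_patterns"
    by (auto simp: admissible_def)
  with abstract_pattern_representative show "is_pattern M" "tclass M \<in> PP"
    by metis+
qed

lemma admissible_hereditary:
  assumes "admissible PP" "P \<in> PP" "Q \<in> abstract_patterns" "contained_in Q P"
  shows "Q \<in> PP"
proof -
  have "\<forall>P\<in>PP. \<forall>Q\<in>abstract_patterns. contained_in Q P \<longrightarrow> Q \<in> PP"
    using assms(1) unfolding admissible_def by (elim conjE)
  then show ?thesis using assms by blast
qed

lemma admissible_extension:
  assumes "admissible PP" "M \<in> \<Union>PP" "0 \<in> supp M" "r > 0"
  obtains N where "N \<in> \<Union>PP" "cball 0 r \<subseteq> supp N"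
proof -
  have "\<forall>P\<in>PP. \<forall>M\<in>P. 0 \<in> supp M \<longrightarrow>
      (\<forall>r>0. \<exists>Q\<in>PP. \<exists>N\<in>Q. cball 0 r \<subseteq> supp N \<and> M \<subseteq> N)"
    using assms(1) unfolding admissible_def by (elim conjE)
  then show ?thesis using assms that by (meson UnionE UnionI)
qed

lemma admissible_subpattern:
  assumes adm: "admissible PP" and M: "M \<in> \<Union>PP" and N: "N \<subseteq> M" "N \<noteq> {}"
  shows "N \<in> \<Union>PP"
proof -
  have "tclass N \<in> abstract_patterns"
    unfolding abstract_patterns_def
    using pattern_subset[OF admissible_pattern(1)[OF adm M] N] by blast
  moreover have "contained_in (tclass N) (tclass M)"
    unfolding contained_in_def using N(1) tclass_self by blast
  ultimately have "tclass N \<in> PP"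
    using admissible_hereditary[OF adm admissible_pattern(2)[OF adm M]] by simp
  then show ?thesis using tclass_self[of N] by blast
qed

lemma admissible_translate:
  assumes "admissible PP" "M \<in> \<Union>PP"
  shows "translate v M \<in> \<Union>PP"
  using admissible_pattern(2)[OF assms] unfolding tclass_def by blast

section \<open>Radii of patterns and diameters of tiles\<close>

lemma bounded_imp_subset_cball:
  fixes S :: "'a::metric_space set"
  assumes "bounded S"
  shows "\<exists>r>0. S \<subseteq> cball x r"
  using bounded_subset_ballD[OF assms, of x] ball_subset_cball by (meson order_trans)

text \<open>A ball of negative radius is empty, so a nonempty support is what bounds the radii below
  and makes the infimum meaningful.\<close>

lemma outradius_le:
  assumes "supp M \<noteq> {}" "supp M \<subseteq> cball x r"
  shows "outradius M \<le> r"
proof -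
  have "0 \<le> r'" if "supp M \<subseteq> cball y r'" for y r'
    using that assms(1) by (metis cball_empty linorder_not_le subset_empty)
  then have "bdd_below {r. \<exists>x. supp M \<subseteq> cball x r}"
    by (intro bdd_belowI[of _ 0]) blast
  then show ?thesis
    unfolding outradius_def by (rule cInf_lower[rotated]) (use assms(2) in blast)
qed

text \<open>Two points of a ball are at most one diameter apart. This supplies the lower bound on
  the outradius that linear repetitivity demands.\<close>

lemma outradius_ge_half_side:
  assumes "bounded (supp M)" "a \<in> supp M" "b \<in> supp M" "i \<in> Basis" "s \<le> b \<bullet> i - a \<bullet> i"
  shows "s / 2 \<le> outradius M"
  unfolding outradius_def
proof (rule cInf_greatest)
  show "{r. \<exists>x. supp M \<subseteq> cball x r} \<noteq> {}"
    using bounded_imp_subset_cball[OF assms(1)] by blast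
next
  fix r assume "r \<in> {r. \<exists>x. supp M \<subseteq> cball x r}"
  then obtain x where x: "supp M \<subseteq> cball x r" by blast
  have "s \<le> norm (b - a)"
    using Basis_le_norm[OF assms(4), of "b - a"] assms(5) by (simp add: inner_diff_left)
  also have "\<dots> \<le> dist x a + dist x b"
    by (metis dist_commute dist_norm dist_triangle2)
  also have "\<dots> \<le> 2 * r"
    using subsetD[OF x assms(2)] subsetD[OF x assms(3)] by simp
  finally show "s / 2 \<le> r" by simp
qed

lemma inradius_ge:
  assumes "bounded (supp M)" "cball x r \<subseteq> supp M"
  shows "r \<le> inradius M"
proof -
  obtain q where q: "0 < q" "supp M \<subseteq> cball 0 q"
    using bounded_imp_subset_cball[OF assms(1)] by blast
  have "r' \<le> q" if "cball y r' \<subseteq> supp M" for y r'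
  proof -
    have "cball y r' \<subseteq> cball 0 q" using that q(2) by blast
    then have "dist y 0 + r' \<le> q \<or> r' < 0" by (simp only: cball_subset_cball_iff)
    moreover have "0 \<le> dist y 0" by simp
    ultimately show ?thesis using q(1) by linarith
  qed
  then have "bdd_above {r. \<exists>x. cball x r \<subseteq> supp M}"
    by (intro bdd_aboveI[of _ q]) blast
  then show ?thesis
    unfolding inradius_def by (rule cSup_upper[rotated]) (use assms(2) in blast)
qed

text \<open>A tile fits into a ball whose radius is bounded by admissibility, and doubling that
  radius allows the centre to be any point of the tile.\<close>

lemma admissible_tile_diameter:
  assumes adm: "admissible PP"
  obtains \<rho> where "\<rho> > 0" "\<And>M t y. M \<in> \<Union>PP \<Longrightarrow> t \<in> M \<Longrightarrow> y \<in> fst t \<Longrightarrow> fst t \<subseteq> cball y \<rho>"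
proof -
  have "\<exists>rmin rmax. 0 < rmin \<and> 0 < rmax \<and> (\<forall>t. tclass {t} \<in> PP \<longrightarrow>
      rmin \<le> class_inradius (tclass {t}) \<and>
      class_inradius (tclass {t}) \<le> class_outradius (tclass {t}) \<and>
      class_outradius (tclass {t}) \<le> rmax)"
    using adm unfolding admissible_def by (elim conjE)
  then obtain rmax where rmax: "rmax > 0"
    "\<And>t. tclass {t} \<in> PP \<Longrightarrow> class_outradius (tclass {t}) \<le> rmax"
    by auto
  have "fst t \<subseteq> cball y (2 * (rmax + 1))" if M: "M \<in> \<Union>PP" and t: "t \<in> M" and y: "y \<in> fst t" for M t y
  proof -
    have t': "{t} \<in> \<Union>PP" by (rule admissible_subpattern[OF adm M]) (use t in auto)
    have "outradius {t} \<le> rmax"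
      using rmax(2)[OF admissible_pattern(2)[OF adm t']] by (simp add: class_outradius_tclass)
    \<comment> \<open>The extra 1 yields an enclosing ball without proving that the infimum is
      attained.\<close>
    then have "Inf {r. \<exists>x. supp {t} \<subseteq> cball x r} < rmax + 1"
      by (simp add: outradius_def)
    moreover have "{r. \<exists>x. supp {t} \<subseteq> cball x r} \<noteq> {}"
      using bounded_imp_subset_cball[OF compact_imp_bounded[OF
          compact_supp[OF admissible_pattern(1)[OF adm t']]]] by blast
    ultimately have "\<exists>r\<in>{r. \<exists>x. supp {t} \<subseteq> cball x r}. r < rmax + 1"
      by (intro cInf_lessD)
    then obtain r x where "supp {t} \<subseteq> cball x r" "r < rmax + 1" by auto
    then have r: "dist x z \<le> rmax + 1" if "z \<in> fst t" for z
      using that by (fastforce simp: supp_def)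
    show ?thesis
    proof
      fix z assume "z \<in> fst t"
      have "dist y z \<le> dist x y + dist x z" by (metis dist_commute dist_triangle)
      then show "z \<in> cball y (2 * (rmax + 1))" using r[OF y] r[OF \<open>z \<in> fst t\<close>] by simp
    qed
  qed
  then show ?thesis using that[of "2 * (rmax + 1)"] rmax(1) by simp
qed

lemma supp_touching_ball:
  assumes "\<And>t y. t \<in> M \<Longrightarrow> y \<in> fst t \<Longrightarrow> fst t \<subseteq> cball y \<rho>" and "B \<subseteq> cball x r"
  shows "supp {t \<in> M. fst t \<inter> B \<noteq> {}} \<subseteq> cball x (r + \<rho>)"
proof
  fix w assume "w \<in> supp {t \<in> M. fst t \<inter> B \<noteq> {}}"
  then obtain t y where t: "t \<in> M" "w \<in> fst t" "y \<in> fst t" "y \<in> B"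
    by (auto simp: supp_def)
  have "dist x w \<le> dist x y + dist y w" by (rule dist_triangle)
  moreover have "dist y w \<le> \<rho>" using assms(1)[OF t(1,3)] t(2) by auto
  moreover have "dist x y \<le> r" using assms(2) t(4) by auto
  ultimately show "w \<in> cball x (r + \<rho>)" by simp
qed

text \<open>Condition (iii) of admissibility extends only patterns whose support contains the
  origin, so a pattern is first translated to bring one of its points there.\<close>

lemma admissible_covers_ball:
  assumes adm: "admissible PP" and "r > 0"
  obtains M where "M \<in> \<Union>PP" "cball 0 r \<subseteq> supp M"
proof -
  obtain P where P: "P \<in> PP" "P \<in> abstract_patterns" using adm by (auto simp: admissible_def)
  then obtain M where "M \<in> P" "is_pattern M"
    using tclass_self by (auto simp: abstract_patterns_def)
  then obtain t where t: "t \<in> M" "is_tile (fst t)" by (auto simp: is_pattern_def)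
  then have "fst t \<noteq> {}"
    by (auto simp: is_tile_def)
  then obtain x where "x \<in> supp M" using t(1) by (auto simp: supp_def)
  then have 0: "0 \<in> supp (translate (- x) M)" by (auto simp: supp_translate image_iff)
  moreover have "translate (- x) M \<in> \<Union>PP"
    using admissible_translate[OF adm] P(1) \<open>M \<in> P\<close> by auto
  ultimately show ?thesis
    using admissible_extension[OF adm] \<open>r > 0\<close> that by metis
qed

text \<open>A linear bound on the size of a pattern covering an \<open>r\<close>-box makes linear repetitivity
  place a copy of it in the middle of every box of width at least \<open>C * r\<close>.\<close>

lemma copies_of_box_patterns:
  fixes PP :: "('a::euclidean_space, 'l) pattern set set"
  assumes adm: "admissible PP" and lr: "linearly_repetitive PP"
  obtains C where "C \<ge> 1"
    "\<forall>r M B M' Q. 2 \<le> r \<longrightarrow> M \<in> \<Union>PP \<longrightarrow> is_r_box r B \<longrightarrow> B \<subseteq> supp M \<longrightarrow>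
       M' \<in> \<Union>PP \<longrightarrow> is_box Q \<longrightarrow> C * r \<le> box_width Q \<longrightarrow> Q \<subseteq> supp M' \<longrightarrow>
       (\<exists>v D. D division_of Q \<and> (+) v ` B \<in> D \<and> (\<forall>K\<in>D. is_box K \<and> r \<le> box_width K) \<and>
         cut_box M' ((+) v ` B) = translate v (cut_box M B))"
proof -
  obtain \<rho> where \<rho>: "\<rho> > 0"
    "\<And>M t y. M \<in> \<Union>PP \<Longrightarrow> t \<in> M \<Longrightarrow> y \<in> fst t \<Longrightarrow> fst t \<subseteq> cball y \<rho>"
    using admissible_tile_diameter[OF adm] by metis
  from lr obtain c where c: "c > 0"
    "\<And>P Q. P \<in> PP \<Longrightarrow> class_outradius P \<ge> 1 \<Longrightarrow> Q \<in> PP \<Longrightarrow>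
       class_inradius Q \<ge> c * class_outradius P \<Longrightarrow> contained_in P Q"
    unfolding linearly_repetitive_def by blast
  define n where "n = real DIM('a)"
  have n: "n \<ge> 1" unfolding n_def using DIM_positive[where 'a='a] by linarith
  \<comment> \<open>Chosen so that half of \<open>C * r\<close> is at least
    \<open>\<kappa> + \<rho> + r\<close>: the radius that linear repetitivity asks for, one tile
    diameter, and a margin \<open>r\<close> to the faces of \<open>Q\<close>. Terms without a factor
    \<open>r\<close> are absorbed using \<open>r \<ge> 1\<close>.\<close>
  define C where "C = 4 * c * n + 2 * c * \<rho> + 2 * \<rho> + 2"
  show ?thesis
  proof (rule that[of C]; (intro allI impI)?)
    show "C \<ge> 1" using c(1) \<rho>(1) n by (simp add: C_def add_nonneg_nonneg add_increasing)
  next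
    fix r M B M' Q
    assume r: "2 \<le> r" and M: "M \<in> \<Union>PP" and rB: "is_r_box r B" and BM: "B \<subseteq> supp M"
      and M': "M' \<in> \<Union>PP" and Q: "is_box Q" "C * r \<le> box_width Q" and QM': "Q \<subseteq> supp M'"
    obtain a b where ab: "\<forall>i\<in>Basis. a \<bullet> i < b \<bullet> i" "B = cbox a b"
      using rB unfolding is_r_box_def is_box_def by blast
    have side: "r \<le> b \<bullet> i - a \<bullet> i" "b \<bullet> i - a \<bullet> i \<le> 2 * r" if "i \<in> Basis" for i
      using rB that ab by (auto simp: is_r_box_def side_length_cbox)
    obtain p q where pq: "\<forall>i\<in>Basis. p \<bullet> i < q \<bullet> i" "Q = cbox p q"
      using Q(1) unfolding is_box_def by blast
    have sideQ: "C * r \<le> q \<bullet> i - p \<bullet> i" if "i \<in> Basis" for i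
      using Q(2) that pq by (auto simp: box_width_ge_iff side_length_cbox)

    \<comment> \<open>\<open>M\<close> may be far larger than \<open>B\<close>. The tiles touching
      \<open>B\<close> have outradius at most \<open>n * (2 * r) + \<rho>\<close>, which is linear
      in \<open>r\<close>.\<close>
    define N where "N = {t \<in> M. fst t \<inter> B \<noteq> {}}"
    have BN: "B \<subseteq> supp N" unfolding N_def by (rule subset_supp_touching[OF BM])
    have abN: "a \<in> supp N" "b \<in> supp N"
      using BN ab by (auto simp: mem_box less_imp_le)
    then have N: "N \<subseteq> M" "N \<noteq> {}" by (auto simp: N_def supp_def)
    then have NPP: "N \<in> \<Union>PP" by (rule admissible_subpattern[OF adm M])
    have "B \<subseteq> cball a (n * (2 * r))"
    proof
      fix x assume x: "x \<in> B"
      have "dist a x \<le> (\<Sum>i\<in>Basis. \<bar>(x - a) \<bullet> i\<bar>)"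
        by (metis dist_commute dist_norm norm_le_l1)
      also have "\<dots> \<le> (\<Sum>i\<in>(Basis::'a set). 2 * r)"
      proof (rule sum_mono)
        fix i :: 'a assume "i \<in> Basis"
        then show "\<bar>(x - a) \<bullet> i\<bar> \<le> 2 * r"
          using x side[of i] by (force simp: ab(2) mem_box inner_diff_left)
      qed
      finally show "x \<in> cball a (n * (2 * r))" by (simp add: n_def)
    qed
    then have suppN: "supp N \<subseteq> cball a (n * (2 * r) + \<rho>)"
      unfolding N_def using \<rho>(2)[OF M] by (intro supp_touching_ball)
    obtain i :: 'a where i: "i \<in> Basis" using nonempty_Basis by blast
    \<comment> \<open>Here \<open>2 \<le> r\<close> pays off: it makes the outradius at least 1, so
      linear repetitivity applies to \<open>N\<close>.\<close>
    have "r / 2 \<le> outradius N"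
      using suppN abN side(1)[OF i] i
      by (intro outradius_ge_half_side[of N a b i]) (auto intro: bounded_subset[OF bounded_cball])
    then have outN1: "1 \<le> class_outradius (tclass N)" using r by (simp add: class_outradius_tclass)
    have outN2: "class_outradius (tclass N) \<le> n * (2 * r) + \<rho>"
      using outradius_le[OF _ suppN] abN by (auto simp: class_outradius_tclass)

    define z where "z = (1 / 2) *\<^sub>R (p + q)"
    define \<kappa> where "\<kappa> = c * (n * (2 * r) + \<rho>)"
    have \<kappa>: "\<kappa> \<ge> 0" using c(1) n r \<rho>(1) by (simp add: \<kappa>_def)
    have half: "\<kappa> + \<rho> + r \<le> C * r / 2"
    proof -
      have "C * r / 2 = c * (n * (2 * r)) + c * \<rho> * r + \<rho> * r + r"
        by (simp add: C_def field_simps)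
      moreover have "c * \<rho> \<le> c * \<rho> * r" "\<rho> \<le> \<rho> * r"
          using mult_left_mono[of 1 r "c * \<rho>"] mult_left_mono[of 1 r \<rho>] c(1) \<rho>(1) r by simp_all
      ultimately show ?thesis by (simp add: \<kappa>_def distrib_left)
    qed
    have z: "p \<bullet> i + C * r / 2 \<le> z \<bullet> i" "z \<bullet> i + C * r / 2 \<le> q \<bullet> i" if "i \<in> Basis" for i
    proof -
      have "z \<bullet> i = (p \<bullet> i + q \<bullet> i) / 2" by (simp add: z_def inner_add_left)
      note this sideQ[OF that]
      then show "p \<bullet> i + C * r / 2 \<le> z \<bullet> i" "z \<bullet> i + C * r / 2 \<le> q \<bullet> i"
        by (simp_all add: field_simps)
    qed
    have near: "\<bar>x \<bullet> i - z \<bullet> i\<bar> \<le> s" if "x \<in> cball z s" "i \<in> Basis" for x s and i :: 'a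
    proof -
      have "\<bar>(x - z) \<bullet> i\<bar> \<le> norm (x - z)" by (rule Basis_le_norm[OF that(2)])
      also have "\<dots> \<le> s" using that(1) by (simp add: dist_norm norm_minus_commute)
      finally show ?thesis by (simp add: inner_diff_left)
    qed
    have ballQ: "cball z \<kappa> \<subseteq> Q"
    proof
      fix x assume x: "x \<in> cball z \<kappa>"
      have "p \<bullet> i \<le> x \<bullet> i \<and> x \<bullet> i \<le> q \<bullet> i" if "i \<in> Basis" for i
        using near[OF x that] z[OF that] half r \<rho>(1) by auto
      then show "x \<in> Q" by (simp add: pq(2) mem_box)
    qed

    \<comment> \<open>Linear repetitivity does not say where in a pattern a copy occurs. Applied to
      the tiles around the centre of \<open>Q\<close> only, it yields a copy away from the faces of
      \<open>Q\<close>.\<close>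
    define N' where "N' = {t \<in> M'. fst t \<inter> cball z \<kappa> \<noteq> {}}"
    have ballN': "cball z \<kappa> \<subseteq> supp N'"
      unfolding N'_def using ballQ QM' by (intro subset_supp_touching) simp
    moreover have "z \<in> cball z \<kappa>" using \<kappa> by simp
    ultimately have "z \<in> supp N'" by (rule subsetD)
    then have N': "N' \<subseteq> M'" "N' \<noteq> {}" by (auto simp: N'_def supp_def)
    then have N'PP: "N' \<in> \<Union>PP" by (rule admissible_subpattern[OF adm M'])
    have suppN': "supp N' \<subseteq> cball z (\<kappa> + \<rho>)"
      unfolding N'_def using \<rho>(2)[OF M'] by (intro supp_touching_ball) auto
    have "\<kappa> \<le> class_inradius (tclass N')"
      using ballN' bounded_subset[OF bounded_cball suppN'] by (simp add: class_inradius_tclass inradius_ge)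
    moreover have "c * class_outradius (tclass N) \<le> \<kappa>"
      unfolding \<kappa>_def using outN2 c(1) by (simp add: mult_left_mono)
    ultimately have "contained_in (tclass N) (tclass N')"
      using c(2) admissible_pattern(2)[OF adm] NPP N'PP outN1 by (meson order_trans)
    then obtain u w where "translate u N \<subseteq> translate w N'"
      unfolding contained_in_def tclass_def by blast
    then have "translate (- w) (translate u N) \<subseteq> translate (- w) (translate w N')"
      unfolding translate_def by (rule image_mono)
    then obtain v where v: "translate v N \<subseteq> N'"
      by (simp add: translate_translate)
    have vB: "(+) v ` B \<subseteq> supp (translate v N)"
      using BN by (simp add: supp_translate image_mono)
    also have "\<dots> \<subseteq> cball z (\<kappa> + \<rho>)"
      using v suppN' unfolding supp_def by blast
    finally have vBz: "(+) v ` B \<subseteq> cball z (\<kappa> + \<rho>)" .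
    have vB_eq: "(+) v ` B = cbox (v + a) (v + b)" by (simp only: ab(2) cbox_translation)
    have "a \<in> B" "b \<in> B" using ab by (auto simp: mem_box less_imp_le)
    then have corners: "v + a \<in> cball z (\<kappa> + \<rho>)" "v + b \<in> cball z (\<kappa> + \<rho>)"
      using vBz by blast+
    \<comment> \<open>The translate of \<open>N\<close> covers the translated box, so the other
      tiles of \<open>M'\<close> do not contribute to the cut.\<close>
    have "cut_box M' ((+) v ` B) = cut_box (translate v N) ((+) v ` B)"
      using v N'(1) vB by (intro cut_box_subpattern admissible_pattern[OF adm M']) auto
    also have "\<dots> = translate v (cut_box M B)"
      using cut_box_subpattern[OF admissible_pattern(1)[OF adm M] N(1) BN]
      by (simp add: cut_box_translate)
    finally have cut: "cut_box M' ((+) v ` B) = translate v (cut_box M B)" .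
    have "\<exists>D. D division_of cbox p q \<and> cbox (v + a) (v + b) \<in> D \<and>
        (\<forall>K\<in>D. is_box K \<and> r \<le> box_width K)"
    proof (rule division_extending_inner_box)
      show "\<forall>i\<in>Basis. r \<le> (v + b) \<bullet> i - (v + a) \<bullet> i"
        using side(1) by (simp add: inner_add_left)
      show "\<forall>i\<in>Basis. p \<bullet> i + r \<le> (v + a) \<bullet> i \<and> (v + b) \<bullet> i + r \<le> q \<bullet> i"
      proof
        fix i :: 'a assume i: "i \<in> Basis"
        show "p \<bullet> i + r \<le> (v + a) \<bullet> i \<and> (v + b) \<bullet> i + r \<le> q \<bullet> i"
          using near[OF corners(1) i] near[OF corners(2) i] z[OF i] half by auto
      qed
    qed (use r in simp)
    then show "\<exists>v D. D division_of Q \<and> (+) v ` B \<in> D \<and> (\<forall>K\<in>D. is_box K \<and> r \<le> box_width K) \<and>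
       cut_box M' ((+) v ` B) = translate v (cut_box M B)"
      using cut unfolding pq(2) vB_eq[symmetric] by blast
  qed
qed

subsection \<open>Subadditive functions\<close>

text \<open>The limit is the infimum of \<open>f + c\<close>. It bounds \<open>f\<close> from below
  up to the vanishing \<open>c\<close>; conversely, one \<open>s\<close> with
  \<open>f s + c s\<close> close to the infimum bounds \<open>f r\<close> for all later
  \<open>r\<close>.\<close>

lemma convergent_of_almost_decreasing:
  fixes f c :: "real \<Rightarrow> real"
  assumes le: "\<And>s r. lo \<le> s \<Longrightarrow> s \<le> r \<Longrightarrow> f r \<le> f s + c s"
    and c: "(c \<longlongrightarrow> 0) at_top" and c0: "\<And>s. lo \<le> s \<Longrightarrow> 0 \<le> c s"
    and bdd: "\<And>s. lo \<le> s \<Longrightarrow> m \<le> f s"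
  shows "\<exists>L. (f \<longlongrightarrow> L) at_top"
proof
  define g where "g s = f s + c s" for s
  define L where "L = (INF s\<in>{lo..}. g s)"
  have bddg: "bdd_below (g ` {lo..})"
    using bdd c0 by (intro bdd_belowI[of _ m]) (force simp: g_def add_increasing2)
  have low: "L \<le> g r" if "lo \<le> r" for r
    unfolding L_def by (rule cINF_lower[OF bddg]) (use that in simp)
  show "(f \<longlongrightarrow> L) at_top"
  proof (rule order_tendstoI)
    fix a assume "a < L"
    then have "\<forall>\<^sub>F r in at_top. c r < L - a" using order_tendstoD(2)[OF c] by simp
    then show "\<forall>\<^sub>F r in at_top. a < f r"
      using eventually_ge_at_top[of lo]
    proof eventually_elim
      case (elim r)
      then show ?case using low[of r] by (simp add: g_def)
    qed
  next
    fix a assume "L < a"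
    then obtain s where "lo \<le> s" "g s < a"
      unfolding L_def using cINF_less_iff[OF _ bddg, of a] by auto
    then show "\<forall>\<^sub>F r in at_top. f r < a"
      using le by (intro eventually_at_top_linorderI[of s]) (force simp: g_def)
  qed
qed

lemma measure_r_box:
  fixes B :: "'a::euclidean_space set"
  assumes "is_r_box r B" "r > 0"
  shows "r ^ DIM('a) \<le> measure lborel B" "measure lborel B \<le> (2 * r) ^ DIM('a)"
proof -
  obtain a b where ab: "\<forall>i\<in>Basis. a \<bullet> i < b \<bullet> i" "B = cbox a b"
    using assms(1) unfolding is_r_box_def is_box_def by blast
  have side: "r \<le> b \<bullet> i - a \<bullet> i" "b \<bullet> i - a \<bullet> i \<le> 2 * r" if "i \<in> Basis" for i
    using assms(1) that ab by (auto simp: is_r_box_def side_length_cbox)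
  have vol: "measure lborel B = (\<Prod>i\<in>Basis. b \<bullet> i - a \<bullet> i)"
    using ab by (simp add: content_cbox less_imp_le inner_diff_left)
  have "(\<Prod>i\<in>(Basis::'a set). r) \<le> (\<Prod>i\<in>Basis. b \<bullet> i - a \<bullet> i)"
    using side assms(2) by (intro prod_mono) auto
  then show "r ^ DIM('a) \<le> measure lborel B" by (simp add: vol)
  have "(\<Prod>i\<in>Basis. b \<bullet> i - a \<bullet> i) \<le> (\<Prod>i\<in>(Basis::'a set). 2 * r)"
    using side ab(1) by (intro prod_mono) (auto simp: less_imp_le)
  then show "measure lborel B \<le> (2 * r) ^ DIM('a)" by (simp add: vol)
qed

lemma box_width_r_box: "is_r_box r B \<Longrightarrow> r \<le> box_width B"
  by (simp add: is_r_box_def box_width_ge_iff)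

text \<open>Fixes witnesses for the constants whose existence \<open>box_subadditive\<close>
  asserts.\<close>

locale subadditive_function =
  fixes PP :: "('a::euclidean_space, 'l) pattern set set"
    and F :: "('a, 'l) pattern set \<Rightarrow> real"
    and dF rF :: real and cF :: "real \<Rightarrow> real"
  assumes adm: "admissible PP"
    and rF: "0 \<le> rF"
    and cF_antimono: "antimono_on {rF..} cF"
    and cF_lim: "(cF \<longlongrightarrow> 0) at_top"
    and subadd: "\<And>P n Ps. P \<in> box_patterns PP \<Longrightarrow>
        (\<And>j. j \<in> {1..n} \<Longrightarrow> Ps j \<in> box_patterns PP \<and> rF \<le> pattern_width (Ps j)) \<Longrightarrow>
        pattern_sum P n Ps \<Longrightarrow>
        F P \<le> (\<Sum>j=1..n. F (Ps j)) + (\<Sum>j=1..n. cF (pattern_width (Ps j)) * pattern_volume (Ps j))"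
    and dF: "\<And>P. P \<in> box_patterns PP \<Longrightarrow> \<bar>F P\<bar> \<le> dF * pattern_volume P"
begin

text \<open>Box-pattern classes are handled through concrete pairs of a pattern and a box, so that
  several boxes can be cut from the same pattern.\<close>

definition occurs_in :: "'a set \<Rightarrow> ('a, 'l) pattern \<Rightarrow> bool" where
  "occurs_in B M \<longleftrightarrow> M \<in> \<Union>PP \<and> is_box B \<and> B \<subseteq> supp M"

definition F_cut :: "('a, 'l) pattern \<Rightarrow> 'a set \<Rightarrow> real" where
  "F_cut M B = F (tclass (cut_box M B))"

lemma box_patterns_iff: "P \<in> box_patterns PP \<longleftrightarrow> (\<exists>M B. occurs_in B M \<and> P = tclass (cut_box M B))"
  unfolding box_patterns_def occurs_in_def by auto

lemma r_box_patterns_iff: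
  "P \<in> r_box_patterns PP r \<longleftrightarrow> (\<exists>M B. occurs_in B M \<and> is_r_box r B \<and> P = tclass (cut_box M B))"
  unfolding r_box_patterns_def occurs_in_def is_r_box_def by auto

lemma occursD:
  assumes "occurs_in B M"
  shows "is_pattern M" "is_box B" "B \<subseteq> supp M"
  using assms admissible_pattern(1)[OF adm, of M] by (simp_all add: occurs_in_def)

lemma occurs_volume: "occurs_in B M \<Longrightarrow> pattern_volume (tclass (cut_box M B)) = measure lborel B"
  by (rule volume_box_pattern[OF occursD])

lemma occurs_width: "occurs_in B M \<Longrightarrow> pattern_width (tclass (cut_box M B)) = box_width B"
  by (rule width_box_pattern[OF occursD])

lemma occurs_supp: "occurs_in B M \<Longrightarrow> supp (cut_box M B) = B"
  by (rule supp_cut_box[OF occursD])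

lemma occurs_measure_pos: "occurs_in B M \<Longrightarrow> 0 < measure lborel B"
  by (simp add: occurs_in_def measure_box_pos)

lemma F_cut_bound: "occurs_in B M \<Longrightarrow> \<bar>F_cut M B\<bar> \<le> dF * measure lborel B"
  unfolding F_cut_def using dF[of "tclass (cut_box M B)"] box_patterns_iff occurs_volume by auto

text \<open>A nonincreasing function stays above its limit.\<close>

lemma cF_nonneg:
  assumes "rF \<le> s"
  shows "0 \<le> cF s"
proof (rule tendsto_upperbound[OF cF_lim])
  show "\<forall>\<^sub>F r in at_top. cF r \<le> cF s"
  proof (rule eventually_at_top_linorderI)
    fix r assume "s \<le> r"
    then show "cF r \<le> cF s"
      using cF_antimono assms by (auto simp: monotone_on_def)
  qed
qed simp

text \<open>Subadditivity restated for divisions of a box within a fixed pattern. As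
  \<open>cF\<close> is nonincreasing, all error terms are bounded through \<open>cF s\<close>, and
  the volumes of the pieces add up to that of \<open>B\<close>.\<close>

lemma F_cut_division:
  assumes B: "occurs_in B M" and D: "D division_of B"
    and K: "\<And>K. K \<in> D \<Longrightarrow> is_box K \<and> s \<le> box_width K" and s: "rF \<le> s"
  shows "F_cut M B \<le> (\<Sum>K\<in>D. F_cut M K) + cF s * measure lborel B"
proof -
  \<comment> \<open>\<open>pattern_sum\<close> takes pieces indexed by \<open>{1..n}\<close>, so the
    division is enumerated from 1.\<close>
  obtain h where h: "bij_betw h {1..card D} D"
    using ex_bij_betw_nat_finite_1 division_ofD(1)[OF D] by blast
  then have hD: "h j \<in> D" if "j \<in> {1..card D}" for j
    using that bij_betwE by blast
  have occ: "occurs_in K M" if "K \<in> D" for K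
    using K[OF that] division_ofD(2)[OF D that] B by (auto simp: occurs_in_def)
  have supp_h: "supp (cut_box M (h j)) = h j" if "j \<in> {1..card D}" for j
    by (rule occurs_supp[OF occ[OF hD[OF that]]])
  have box: "is_box (h j)" if "j \<in> {1..card D}" for j
    using K[OF hD[OF that]] by (rule conjunct1)
  have disj: "disjoint_upto_boundary (h i) (h j)"
    if i: "i \<in> {1..card D}" and j: "j \<in> {1..card D}" and ne: "i \<noteq> j" for i j
  proof -
    have "h i \<noteq> h j" using inj_onD[OF bij_betw_imp_inj_on[OF h]] i j ne by metis
    then show ?thesis
      unfolding disjoint_upto_boundary_def by (rule division_ofD(5)[OF D hD[OF i] hD[OF j]])
  qed
  have Un: "(\<Union>j\<in>{1..card D}. h j) = B"
    unfolding bij_betw_imp_surj_on[OF h] by (rule division_ofD(6)[OF D])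
  have "box_sum B (card D) h"
    unfolding box_sum_def using occursD(2)[OF B] box disj Un by simp
  then have "box_sum (supp (cut_box M B)) (card D) (\<lambda>j. supp (cut_box M (h j)))"
    unfolding box_sum_def occurs_supp[OF B] by (simp add: supp_h)
  moreover have "cut_box M (h j) = cut_box (cut_box M B) (supp (cut_box M (h j)))"
    if "j \<in> {1..card D}" for j
    unfolding supp_h[OF that] using division_ofD(2)[OF D hD[OF that]]
    by (rule cut_box_cut_box[symmetric])
  ultimately have sum: "pattern_sum (tclass (cut_box M B)) (card D) (\<lambda>j. tclass (cut_box M (h j)))"
    unfolding pattern_sum_def
    by (intro bexI[of _ "cut_box M B"] exI[of _ "\<lambda>j. cut_box M (h j)"] conjI ballI)
      (assumption | rule tclass_self)+
  have "F_cut M B \<le> (\<Sum>j=1..card D. F_cut M (h j)) +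
      (\<Sum>j=1..card D. cF (pattern_width (tclass (cut_box M (h j)))) *
        pattern_volume (tclass (cut_box M (h j))))"
    unfolding F_cut_def
  proof (rule subadd[OF _ _ sum])
    show "tclass (cut_box M B) \<in> box_patterns PP" using B box_patterns_iff by blast
    show "tclass (cut_box M (h j)) \<in> box_patterns PP \<and> rF \<le> pattern_width (tclass (cut_box M (h j)))"
      if "j \<in> {1..card D}" for j
    proof
      show "tclass (cut_box M (h j)) \<in> box_patterns PP"
        using occ[OF hD[OF that]] box_patterns_iff by blast
      show "rF \<le> pattern_width (tclass (cut_box M (h j)))"
        using occurs_width[OF occ[OF hD[OF that]]] K[OF hD[OF that]] s by simp
    qed
  qed
  also have "(\<Sum>j=1..card D. F_cut M (h j)) = (\<Sum>K\<in>D. F_cut M K)"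
    by (rule sum.reindex_bij_betw[OF h])
  also have "(\<Sum>j=1..card D. cF (pattern_width (tclass (cut_box M (h j)))) *
      pattern_volume (tclass (cut_box M (h j)))) =
      (\<Sum>K\<in>D. cF (pattern_width (tclass (cut_box M K))) * pattern_volume (tclass (cut_box M K)))"
    by (rule sum.reindex_bij_betw[OF h])
  also have "\<dots> \<le> (\<Sum>K\<in>D. cF s * measure lborel K)"
  proof (rule sum_mono)
    fix K assume KD: "K \<in> D"
    have "cF (box_width K) \<le> cF s"
      using cF_antimono K[OF KD] s by (auto simp: monotone_on_def)
    then show "cF (pattern_width (tclass (cut_box M K))) * pattern_volume (tclass (cut_box M K))
        \<le> cF s * measure lborel K"
      using occurs_width[OF occ[OF KD]] occurs_volume[OF occ[OF KD]]
      by (simp add: mult_right_mono)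
  qed
  also have "\<dots> = cF s * measure lborel B"
    using B D additive_content_division
    by (auto simp: occurs_in_def is_box_def simp flip: sum_distrib_left)
  finally show ?thesis by simp
qed

section \<open>Upper and lower means over r-boxes\<close>

lemma mean_image:
  "(\<lambda>P. F P / pattern_volume P) ` r_box_patterns PP r =
    {F_cut M B / measure lborel B | M B. occurs_in B M \<and> is_r_box r B}"
proof (intro set_eqI iffI)
  fix x assume "x \<in> (\<lambda>P. F P / pattern_volume P) ` r_box_patterns PP r"
  then obtain M B where "occurs_in B M" "is_r_box r B"
    "x = F (tclass (cut_box M B)) / pattern_volume (tclass (cut_box M B))"
    unfolding image_iff Bex_def r_box_patterns_iff by auto
  then have "x = F_cut M B / measure lborel B" "occurs_in B M" "is_r_box r B"
    by (simp_all add: F_cut_def occurs_volume)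
  then show "x \<in> {F_cut M B / measure lborel B | M B. occurs_in B M \<and> is_r_box r B}" by blast
next
  fix x assume "x \<in> {F_cut M B / measure lborel B | M B. occurs_in B M \<and> is_r_box r B}"
  then obtain M B where B: "occurs_in B M" "is_r_box r B" and x: "x = F_cut M B / measure lborel B"
    by auto
  then have "tclass (cut_box M B) \<in> r_box_patterns PP r"
    unfolding r_box_patterns_iff by blast
  then show "x \<in> (\<lambda>P. F P / pattern_volume P) ` r_box_patterns PP r"
    by (rule rev_image_eqI) (simp add: x F_cut_def occurs_volume[OF B(1)])
qed

lemma mean_bound:
  assumes "occurs_in B M"
  shows "- dF \<le> F_cut M B / measure lborel B" "F_cut M B / measure lborel B \<le> dF"
  using F_cut_bound[OF assms] occurs_measure_pos[OF assms]
  by (auto simp: field_simps abs_le_iff)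

lemma mean_le_upper_mean:
  assumes "occurs_in B M" "is_r_box r B"
  shows "F_cut M B / measure lborel B \<le> upper_mean PP F r"
proof -
  have "bdd_above {F_cut M B / measure lborel B | M B. occurs_in B M \<and> is_r_box r B}"
    using mean_bound(2) by (intro bdd_aboveI[of _ dF]) blast
  then show ?thesis
    unfolding upper_mean_def mean_image using assms by (intro cSup_upper) blast+
qed

lemma lower_mean_le_mean:
  assumes "occurs_in B M" "is_r_box r B"
  shows "lower_mean PP F r \<le> F_cut M B / measure lborel B"
proof -
  have "bdd_below {F_cut M B / measure lborel B | M B. occurs_in B M \<and> is_r_box r B}"
    using mean_bound(1) by (intro bdd_belowI[of _ "- dF"]) blast
  then show ?thesis
    unfolding lower_mean_def mean_image using assms by (intro cInf_lower) blast+
qed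

text \<open>Nonemptiness of the set of means, without which its supremum and infimum could not be
  estimated.\<close>

lemma r_box_occurs:
  assumes "r > 0"
  obtains M B where "occurs_in B M" "is_r_box r B"
proof -
  define B :: "'a set" where "B = cbox 0 (r *\<^sub>R One)"
  have side: "\<forall>i\<in>Basis. (0::'a) \<bullet> i < (r *\<^sub>R One) \<bullet> i" using assms by simp
  have B: "is_r_box r B"
    unfolding B_def is_r_box_def using side assms by (simp add: is_box_cbox side_length_cbox)
  have "\<exists>q>0. B \<subseteq> cball 0 q"
    unfolding B_def by (rule bounded_imp_subset_cball[OF bounded_cbox])
  then obtain q where "q > 0" "B \<subseteq> cball 0 q" by blast
  moreover from this(1) obtain M where "M \<in> \<Union>PP" "cball 0 q \<subseteq> supp M"
    by (rule admissible_covers_ball[OF adm])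
  ultimately have "occurs_in B M" using B by (auto simp: occurs_in_def is_r_box_def)
  then show ?thesis using that B by blast
qed

lemma upper_mean_least:
  assumes "r > 0" "\<And>M B. occurs_in B M \<Longrightarrow> is_r_box r B \<Longrightarrow> F_cut M B / measure lborel B \<le> x"
  shows "upper_mean PP F r \<le> x"
proof -
  obtain M B where "occurs_in B M" "is_r_box r B" using r_box_occurs[OF assms(1)] .
  then show ?thesis
    unfolding upper_mean_def mean_image by (intro cSup_least) (use assms(2) in blast)+
qed

lemma lower_mean_greatest:
  assumes "r > 0" "\<And>M B. occurs_in B M \<Longrightarrow> is_r_box r B \<Longrightarrow> x \<le> F_cut M B / measure lborel B"
  shows "x \<le> lower_mean PP F r"
proof -
  obtain M B where "occurs_in B M" "is_r_box r B" using r_box_occurs[OF assms(1)] .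
  then show ?thesis
    unfolding lower_mean_def mean_image by (intro cInf_greatest) (use assms(2) in blast)+
qed

lemma lower_mean_le_upper_mean:
  assumes "r > 0"
  shows "lower_mean PP F r \<le> upper_mean PP F r"
proof -
  obtain M B where B: "occurs_in B M" "is_r_box r B" using r_box_occurs[OF assms] .
  from lower_mean_le_mean[OF B] mean_le_upper_mean[OF B] show ?thesis by (rule order_trans)
qed

section \<open>Convergence of the upper mean\<close>

text \<open>Stated for every box of width at least \<open>s\<close>, since it is also applied to the
  pieces around a copy, whose sides may be very unequal.\<close>

lemma F_cut_le_upper_mean:
  assumes B: "occurs_in B M" and s: "s > 0" "rF \<le> s" "s \<le> box_width B"
  shows "F_cut M B \<le> (upper_mean PP F s + cF s) * measure lborel B"
proof -
  have "is_box B" using B by (simp add: occurs_in_def)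
  then obtain D where D: "D division_of B" "\<forall>K\<in>D. is_r_box s K"
    using division_into_r_boxes[OF s(1) _ s(3)] by blast
  have vol: "(\<Sum>K\<in>D. measure lborel K) = measure lborel B"
    using \<open>is_box B\<close> D(1) additive_content_division by (auto simp: is_box_def)
  have "F_cut M B \<le> (\<Sum>K\<in>D. F_cut M K) + cF s * measure lborel B"
    using D(2) by (intro F_cut_division[OF B D(1) _ s(2)]) (auto simp: is_r_box_def box_width_r_box)
  also have "(\<Sum>K\<in>D. F_cut M K) \<le> (\<Sum>K\<in>D. upper_mean PP F s * measure lborel K)"
  proof (rule sum_mono)
    fix K assume K: "K \<in> D"
    then have occ: "occurs_in K M" "is_r_box s K"
      using B D(2) division_ofD(2)[OF D(1) K] by (auto simp: occurs_in_def is_r_box_def)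
    then show "F_cut M K \<le> upper_mean PP F s * measure lborel K"
      using mean_le_upper_mean[OF occ] occurs_measure_pos[OF occ(1)] by (simp add: pos_divide_le_eq)
  qed
  also have "\<dots> = upper_mean PP F s * measure lborel B"
    by (simp add: vol flip: sum_distrib_left)
  finally show ?thesis by (simp add: distrib_right)
qed

lemma upper_mean_almost_decreasing:
  assumes "s > 0" "rF \<le> s" "s \<le> r"
  shows "upper_mean PP F r \<le> upper_mean PP F s + cF s"
proof (rule upper_mean_least)
  fix M B assume B: "occurs_in B M" "is_r_box r B"
  have "s \<le> box_width B" using box_width_r_box[OF B(2)] assms(3) by simp
  from F_cut_le_upper_mean[OF B(1) assms(1,2) this]
  show "F_cut M B / measure lborel B \<le> upper_mean PP F s + cF s"
    using occurs_measure_pos[OF B(1)] by (simp add: pos_divide_le_eq)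
qed (use assms in simp)

lemma upper_mean_convergent: "\<exists>L. (upper_mean PP F \<longlongrightarrow> L) at_top"
\<comment> \<open>\<open>rF\<close> may be 0, whereas the means are only controlled for positive
  \<open>r\<close>; hence the maximum with 1.\<close>
proof (rule convergent_of_almost_decreasing[where lo = "max 1 rF" and c = cF and m = "- dF"])
  fix s assume s: "max 1 rF \<le> s"
  then have "0 < s" by simp
  then obtain M B where B: "occurs_in B M" "is_r_box s B" by (rule r_box_occurs)
  from mean_bound(1)[OF B(1)] mean_le_upper_mean[OF B]
  show "- dF \<le> upper_mean PP F s" by (rule order_trans)
  show "0 \<le> cF s" using s by (intro cF_nonneg) simp
  show "upper_mean PP F r \<le> upper_mean PP F s + cF s" if "s \<le> r" for r
    using s that by (intro upper_mean_almost_decreasing) auto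
qed (rule cF_lim)

text \<open>Every \<open>C * r\<close>-box contains a copy of each \<open>r\<close>-box pattern, which occupies at least the
  fraction \<open>\<delta>\<close> of its volume: a low mean on the copy would pull down the mean of all
  \<open>C * r\<close>-boxes.\<close>

lemma mean_gap:
  assumes lr: "linearly_repetitive PP"
  obtains C \<delta> where "C \<ge> 1" "\<delta> > 0"
    "\<forall>r. 2 \<le> r \<longrightarrow> rF \<le> r \<longrightarrow>
      upper_mean PP F r - (upper_mean PP F r + 2 * cF r - upper_mean PP F (C * r)) / \<delta>
        \<le> lower_mean PP F r"
proof -
  obtain C where C: "C \<ge> 1" and copies:
    "\<forall>r M B M' Q. 2 \<le> r \<longrightarrow> M \<in> \<Union>PP \<longrightarrow> is_r_box r B \<longrightarrow> B \<subseteq> supp M \<longrightarrow>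
       M' \<in> \<Union>PP \<longrightarrow> is_box Q \<longrightarrow> C * r \<le> box_width Q \<longrightarrow> Q \<subseteq> supp M' \<longrightarrow>
       (\<exists>v D. D division_of Q \<and> (+) v ` B \<in> D \<and> (\<forall>K\<in>D. is_box K \<and> r \<le> box_width K) \<and>
         cut_box M' ((+) v ` B) = translate v (cut_box M B))"
    by (rule copies_of_box_patterns[OF adm lr])
  \<comment> \<open>An r-box has volume at least \<open>r ^ DIM('a)\<close>, a
    \<open>C * r\<close>-box at most \<open>(2 * (C * r)) ^ DIM('a)\<close>.\<close>
  define \<delta> where "\<delta> = 1 / (2 * C) ^ DIM('a)"
  have \<delta>: "\<delta> > 0" using C by (simp add: \<delta>_def)
  show ?thesis
  proof (rule that[OF C \<delta>], intro allI impI)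
    fix r assume r: "2 \<le> r" "rF \<le> r"
    define U where "U = upper_mean PP F r"
    show "upper_mean PP F r - (upper_mean PP F r + 2 * cF r - upper_mean PP F (C * r)) / \<delta>
        \<le> lower_mean PP F r"
    proof (rule lower_mean_greatest)
      fix M B assume B: "occurs_in B M" "is_r_box r B"
      define x where "x = F_cut M B / measure lborel B"
      have xU: "x \<le> U" unfolding x_def U_def by (rule mean_le_upper_mean[OF B])
      have "upper_mean PP F (C * r) \<le> U + 2 * cF r - \<delta> * (U - x)"
      proof (rule upper_mean_least)
        fix M' Q assume Q: "occurs_in Q M'" "is_r_box (C * r) Q"
        obtain v D where D: "D division_of Q" and vB: "(+) v ` B \<in> D"
          and DK: "\<forall>K\<in>D. is_box K \<and> r \<le> box_width K"
          and cut: "cut_box M' ((+) v ` B) = translate v (cut_box M B)"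
          using copies[rule_format, of r M B M' Q] r B Q box_width_r_box[OF Q(2)]
          unfolding occurs_in_def by blast
        define B' where "B' = (+) v ` B"
        have occ: "occurs_in K M'" if "K \<in> D" for K
          using DK that division_ofD(2)[OF D that] Q(1) by (auto simp: occurs_in_def)
        have F_B': "F_cut M' B' = F_cut M B"
          by (simp add: F_cut_def B'_def cut tclass_translate)
        have vol_B': "measure lborel B' = measure lborel B"
          using occurs_volume[OF occ[OF vB]] occurs_volume[OF B(1)]
          by (simp add: B'_def cut tclass_translate)
        have finD: "finite D" by (rule division_ofD(1)[OF D])
        have vol: "(\<Sum>K\<in>D. measure lborel K) = measure lborel Q"
          using Q(1) D additive_content_division by (auto simp: occurs_in_def is_box_def)
        have vol': "(\<Sum>K\<in>D - {B'}. measure lborel K) = measure lborel Q - measure lborel B"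
          using vol vol_B' finD vB by (simp add: sum_diff1 B'_def)
        have "F_cut M' Q \<le> (\<Sum>K\<in>D. F_cut M' K) + cF r * measure lborel Q"
          using DK by (intro F_cut_division[OF Q(1) D _ r(2)]) auto
        also have "(\<Sum>K\<in>D. F_cut M' K) = F_cut M' B' + (\<Sum>K\<in>D - {B'}. F_cut M' K)"
          using finD vB by (simp add: sum.remove B'_def)
        \<comment> \<open>These pieces need not be r-boxes, and subdividing them costs a second
          error \<open>cF r\<close> besides that of the division of \<open>Q\<close>.\<close>
        also have "(\<Sum>K\<in>D - {B'}. F_cut M' K) \<le> (\<Sum>K\<in>D - {B'}. (U + cF r) * measure lborel K)"
          unfolding U_def using r DK occ by (intro sum_mono F_cut_le_upper_mean) auto
        also have "\<dots> = (U + cF r) * (measure lborel Q - measure lborel B)"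
          by (simp add: vol' flip: sum_distrib_left)
        finally have FQ: "F_cut M' Q \<le> F_cut M B + (U + cF r) * (measure lborel Q - measure lborel B)
            + cF r * measure lborel Q"
          by (simp add: F_B')
        have posB: "0 < measure lborel B" and posQ: "0 < measure lborel Q"
          using B(1) Q(1) occurs_measure_pos by blast+
        define \<theta> where "\<theta> = measure lborel B / measure lborel Q"
        have "measure lborel Q \<le> (2 * (C * r)) ^ DIM('a)"
          using C r by (intro measure_r_box(2)[OF Q(2)]) simp
        also have "\<dots> = (2 * C) ^ DIM('a) * r ^ DIM('a)"
          by (simp add: power_mult_distrib)
        also have "\<dots> \<le> (2 * C) ^ DIM('a) * measure lborel B"
          using C r by (intro mult_left_mono measure_r_box(1)[OF B(2)]) auto
        finally have \<theta>: "\<delta> \<le> \<theta>"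
          using posQ C by (simp add: \<theta>_def \<delta>_def field_simps)
        have \<theta>0: "0 \<le> \<theta>" using \<theta> \<delta> by simp
        have "F_cut M' Q / measure lborel Q \<le>
            (x * measure lborel B + (U + cF r) * (measure lborel Q - measure lborel B)
            + cF r * measure lborel Q) / measure lborel Q"
          using FQ posB posQ by (intro divide_right_mono) (simp_all add: x_def)
        also have "\<dots> = U + 2 * cF r - \<theta> * (U - x) - \<theta> * cF r"
          using posQ by (simp add: \<theta>_def field_simps)
        \<comment> \<open>The nonnegative term \<open>\<theta> * cF r\<close> is dropped, and
          \<open>\<theta>\<close> is replaced by \<open>\<delta>\<close>, which is legitimate
          because \<open>x \<le> U\<close>.\<close>
        also have "\<dots> \<le> U + 2 * cF r - \<delta> * (U - x)"
          using mult_right_mono[OF \<theta>, of "U - x"] xU mult_nonneg_nonneg[OF \<theta>0 cF_nonneg[OF r(2)]]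
          by linarith
        finally show "F_cut M' Q / measure lborel Q \<le> U + 2 * cF r - \<delta> * (U - x)" .
      qed (use C r in simp)
      then have "\<delta> * (U - x) \<le> U + 2 * cF r - upper_mean PP F (C * r)" by simp
      then have "U - x \<le> (U + 2 * cF r - upper_mean PP F (C * r)) / \<delta>"
        using \<delta> by (simp add: pos_le_divide_eq mult.commute)
      then show "upper_mean PP F r - (upper_mean PP F r + 2 * cF r - upper_mean PP F (C * r)) / \<delta>
          \<le> F_cut M B / measure lborel B"
        by (simp add: U_def x_def)
    qed (use r in simp)
  qed
qed

section \<open>Equality of the limits\<close>

text \<open>The lower mean is squeezed between the bound of \<open>mean_gap\<close> and the upper
  mean. Since \<open>C * r\<close> tends to infinity with \<open>r\<close>, the bracket in that
  bound tends to 0.\<close>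

lemma lower_mean_tendsto:
  assumes lr: "linearly_repetitive PP" and L: "(upper_mean PP F \<longlongrightarrow> L) at_top"
  shows "(lower_mean PP F \<longlongrightarrow> L) at_top"
proof -
  obtain C \<delta> where C: "C \<ge> 1" and \<delta>: "\<delta> > 0" and gap:
    "\<forall>r. 2 \<le> r \<longrightarrow> rF \<le> r \<longrightarrow>
      upper_mean PP F r - (upper_mean PP F r + 2 * cF r - upper_mean PP F (C * r)) / \<delta>
        \<le> lower_mean PP F r"
    by (rule mean_gap[OF lr])
  have "filterlim (\<lambda>r. C * r) at_top at_top"
    using C by (intro filterlim_tendsto_pos_mult_at_top[OF tendsto_const] filterlim_ident) simp
  then have "((\<lambda>r. upper_mean PP F (C * r)) \<longlongrightarrow> L) at_top"
    by (rule filterlim_compose[OF L])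
  then have "((\<lambda>r. upper_mean PP F r -
      (upper_mean PP F r + 2 * cF r - upper_mean PP F (C * r)) / \<delta>) \<longlongrightarrow> L - (L + 2 * 0 - L) / \<delta>) at_top"
    using L cF_lim \<delta> by (intro tendsto_intros) auto
  then have "((\<lambda>r. upper_mean PP F r -
      (upper_mean PP F r + 2 * cF r - upper_mean PP F (C * r)) / \<delta>) \<longlongrightarrow> L) at_top" (is "(?low \<longlongrightarrow> L) at_top")
    by simp
  show ?thesis
  proof (rule tendsto_sandwich[OF _ _ \<open>(?low \<longlongrightarrow> L) at_top\<close> L])
    show "\<forall>\<^sub>F r in at_top. upper_mean PP F r -
        (upper_mean PP F r + 2 * cF r - upper_mean PP F (C * r)) / \<delta> \<le> lower_mean PP F r"
      by (rule eventually_at_top_linorderI[of "max 2 rF"]) (simp add: gap)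
    show "\<forall>\<^sub>F r in at_top. lower_mean PP F r \<le> upper_mean PP F r"
      by (rule eventually_at_top_linorderI[of 1]) (simp add: lower_mean_le_upper_mean)
  qed
qed

text \<open>The sides of an r-box are at most \<open>2 * r\<close>, so a large volume forces a large
  \<open>r\<close>, and the mean of the pattern lies between the lower and the upper mean at that
  \<open>r\<close>.\<close>

lemma large_volume_mean_tendsto:
  assumes U: "(upper_mean PP F \<longlongrightarrow> L) at_top" and L: "(lower_mean PP F \<longlongrightarrow> L) at_top"
  shows "((\<lambda>P. F P / pattern_volume P) \<longlongrightarrow> L) (pattern_volume going_to at_top within all_r_box_patterns PP)"
proof -
  \<comment> \<open>\<open>T\<close> stands for either of the one-sided bounds that make up
    convergence in the order topology.\<close>
  have transfer: "\<forall>\<^sub>F P in pattern_volume going_to at_top within all_r_box_patterns PP. T (F P / pattern_volume P)"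
    if ev: "\<forall>\<^sub>F r in at_top. \<forall>x. lower_mean PP F r \<le> x \<and> x \<le> upper_mean PP F r \<longrightarrow> T x" for T
  proof -
    obtain R where R: "\<And>r x. R \<le> r \<Longrightarrow> lower_mean PP F r \<le> x \<Longrightarrow> x \<le> upper_mean PP F r \<Longrightarrow> T x"
      using ev unfolding eventually_at_top_linorder by blast
    have "T (F P / pattern_volume P)"
      if P: "P \<in> all_r_box_patterns PP" and vol: "(2 * R) ^ DIM('a) < pattern_volume P" for P
    proof -
      obtain r where r: "r > 0" and "P \<in> r_box_patterns PP r"
        using P unfolding all_r_box_patterns_def by auto
      then obtain M B where B: "occurs_in B M" "is_r_box r B" and PB: "P = tclass (cut_box M B)"
        unfolding r_box_patterns_iff by blast
      have "(2 * R) ^ DIM('a) < measure lborel B"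
        using vol by (simp only: PB occurs_volume[OF B(1)])
      also have "\<dots> \<le> (2 * r) ^ DIM('a)" by (rule measure_r_box(2)[OF B(2) r])
      finally have "(2 * R) ^ DIM('a) < (2 * r) ^ DIM('a)" .
      \<comment> \<open>By contraposition: monotonicity of powers is applied to the positive base
        \<open>2 * r\<close>, so \<open>R\<close> may have any sign.\<close>
      then have "R \<le> r"
        using power_mono[of "2 * r" "2 * R" "DIM('a)"] r by linarith
      moreover have "F P / pattern_volume P = F_cut M B / measure lborel B"
        using occurs_volume[OF B(1)] PB by (simp add: F_cut_def)
      ultimately show ?thesis
        using R[OF _ lower_mean_le_mean[OF B] mean_le_upper_mean[OF B]] by simp
    qed
    then show ?thesis unfolding eventually_going_to_at_top_dense by blast
  qed
  show ?thesis
  proof (rule order_tendstoI)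
    fix a assume "a < L"
    from order_tendstoD(1)[OF L this]
    have "\<forall>\<^sub>F r in at_top. \<forall>x. lower_mean PP F r \<le> x \<and> x \<le> upper_mean PP F r \<longrightarrow> a < x"
      by eventually_elim auto
    then show "\<forall>\<^sub>F P in pattern_volume going_to at_top within all_r_box_patterns PP. a < F P / pattern_volume P"
      by (rule transfer)
  next
    fix a assume "L < a"
    from order_tendstoD(2)[OF U this]
    have "\<forall>\<^sub>F r in at_top. \<forall>x. lower_mean PP F r \<le> x \<and> x \<le> upper_mean PP F r \<longrightarrow> x < a"
      by eventually_elim auto
    then show "\<forall>\<^sub>F P in pattern_volume going_to at_top within all_r_box_patterns PP. F P / pattern_volume P < a"
      by (rule transfer)
  qed
qed

end

theorem theorem1:
  fixes PP :: "('a::euclidean_space, 'l) pattern set set"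
    and F :: "('a, 'l) pattern set \<Rightarrow> real"
  assumes "admissible PP"
    and "linearly_repetitive PP"
    and "box_subadditive PP F"
  shows "\<exists>L. (upper_mean PP F \<longlongrightarrow> L) at_top \<and>
             (lower_mean PP F \<longlongrightarrow> L) at_top \<and>
             ((\<lambda>P. F P / pattern_volume P) \<longlongrightarrow> L)
               (pattern_volume going_to at_top within all_r_box_patterns PP)"
proof -
  obtain dF rF cF where const: "0 \<le> rF" "antimono_on {rF..} cF" "(cF \<longlongrightarrow> (0::real)) at_top"
    and sub: "\<forall>P\<in>box_patterns PP. \<forall>n Ps.
        (\<forall>j\<in>{1..n}. Ps j \<in> box_patterns PP \<and> rF \<le> pattern_width (Ps j)) \<and> pattern_sum P n Ps \<longrightarrow>
        F P \<le> (\<Sum>j=1..n. F (Ps j)) + (\<Sum>j=1..n. cF (pattern_width (Ps j)) * pattern_volume (Ps j))"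
    and bound: "\<forall>P\<in>box_patterns PP. \<bar>F P\<bar> \<le> dF * pattern_volume P"
    using assms(3) unfolding box_subadditive_def by (elim exE conjE)
  interpret subadditive_function PP F dF rF cF
    by unfold_locales (use assms(1) const sub bound in \<open>auto\<close>)
  obtain L where "(upper_mean PP F \<longlongrightarrow> L) at_top" using upper_mean_convergent by blast
  then show ?thesis
    using lower_mean_tendsto[OF assms(2)] large_volume_mean_tendsto by blast
qed

end
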